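(* Let $r\ge1$, $\alpha\in(0,1)$, let $\|\cdot\|$ be a norm on $\mathbb{R}^{d+1}$ with dual norm $\|\cdot\|_*$, and let $\mathbb{P}$ be a Borel probability measure on $\mathbb{R}^{d+1}$ with compact support. Let $\mathbb{P}_n$ be the empirical measure of $n$ i.i.d. draws from $\mathbb{P}$. Then, with probability at least $1-\alpha$, $$\overline{\mathcal{W}}_r(\mathbb{P}_n,\mathbb{P})^r\le\frac{C}{\sqrt n},\qquad\text{where}\quad C=\left(180\sqrt{d+2}+\sqrt{2\log(1/\alpha)}\right)\operatorname{diam}(\operatorname{supp}(\mathbb{P}))^r,$$ and $\operatorname{diam}(\operatorname{supp}(\mathbb{P}))=\sup\{\|\mathbf{x}-\tilde{\mathbf{x}}\|_*:\mathbf{x},\tilde{\mathbf{x}}\in\operatorname{supp}(\mathbb{P})\}$.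
   Context: The dual norm is $\|\mathbf{x}\|_*=\sup_{\|\mathbf{y}\|=1}\mathbf{x}^\top\mathbf{y}$. For $\boldsymbol\gamma\in\mathbb{R}^{d+1}$ and a probability measure $\mathbb{Q}$ on $\mathbb{R}^{d+1}$, $\mathbb{Q}_{\boldsymbol\gamma}$ is the law of $\mathbf{z}^\top\boldsymbol\gamma$ when $\mathbf{z}\sim\mathbb{Q}$. The max-sliced Wasserstein distance on $(\mathbb{R}^{d+1},\|\cdot\|)$ is $$\overline{\mathcal{W}}_r(\mathbb{P},\widetilde{\mathbb{P}})=\sup_{\|\boldsymbol\gamma\|=1}\mathcal{W}_r(\mathbb{P}_{\boldsymbol\gamma},\widetilde{\mathbb{P}}_{\boldsymbol\gamma}),$$ where $\mathcal{W}_r$ is the $r$-Wasserstein distance on $\mathbb{R}$, $\mathcal{W}_r(\mu,\nu)=\inf_{\pi\in\Pi(\mu,\nu)}(\mathbb{E}_\pi|U-V|^r)^{1/r}$, the infimum being over couplings $(U,V)\sim\pi$ of $\mu$ and $\nu$. *)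

theory Defs
  imports "HOL-Probability.Probability"
begin

text \<open>Norms on a real vector space, as predicates: the statement quantifies over an arbitrary
  norm, whereas the type class constant \<open>norm\<close> is the Euclidean one on \<open>real ^ 'k\<close>.\<close>

definition is_norm :: "('a::real_vector \<Rightarrow> real) \<Rightarrow> bool" where
  "is_norm N \<longleftrightarrow>
     (\<forall>x. 0 \<le> N x) \<and> (\<forall>x. N x = 0 \<longleftrightarrow> x = 0) \<and>
     (\<forall>c x. N (c *\<^sub>R x) = \<bar>c\<bar> * N x) \<and> (\<forall>x y. N (x + y) \<le> N x + N y)"

definition dual_norm :: "('a::real_inner \<Rightarrow> real) \<Rightarrow> 'a \<Rightarrow> real" where
  "dual_norm N x = (SUP y\<in>{y. N y = 1}. x \<bullet> y)"

definition measure_support :: "'a::topological_space measure \<Rightarrow> 'a set" where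
  "measure_support P = {x. \<forall>U. open U \<and> x \<in> U \<longrightarrow> emeasure P U > 0}"

definition norm_diam :: "('a::real_vector \<Rightarrow> real) \<Rightarrow> 'a set \<Rightarrow> real" where
  "norm_diam N S = (SUP (x, y)\<in>S \<times> S. N (x - y))"

text \<open>The law of \<open>x i\<close> for \<open>i\<close> uniform on \<open>{..<n}\<close>, that is, the average of the \<open>n\<close> point masses at
  \<open>x 0, \<dots>, x (n - 1)\<close>, counted with multiplicity.\<close>

definition empirical_measure :: "nat \<Rightarrow> (nat \<Rightarrow> 'a::topological_space) \<Rightarrow> 'a measure" where
  "empirical_measure n x = distr (uniform_count_measure {..<n}) borel x"

lemma emeasure_empirical_measure:
  assumes "n > 0" "A \<in> sets borel"
  shows "emeasure (empirical_measure n x) A = ennreal (card {i\<in>{..<n}. x i \<in> A} / n)"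
proof -
  have "x \<in> measurable (uniform_count_measure {..<n}) borel"
    by (auto simp: measurable_def space_uniform_count_measure sets_uniform_count_measure)
  moreover have "x -` A \<inter> {..<n} = {i\<in>{..<n}. x i \<in> A}"
    by auto
  moreover have "{i\<in>{..<n}. x i \<in> A} \<subseteq> {..<n}"
    by auto
  ultimately show ?thesis
    using assms emeasure_uniform_count_measure[of "{..<n}" "{i\<in>{..<n}. x i \<in> A}"]
    unfolding empirical_measure_def
    by (simp add: emeasure_distr space_uniform_count_measure)
qed

definition sliced :: "'a::euclidean_space \<Rightarrow> 'a measure \<Rightarrow> real measure" where
  "sliced \<gamma> Q = distr Q borel (\<lambda>z. z \<bullet> \<gamma>)"

definition couplings :: "real measure \<Rightarrow> real measure \<Rightarrow> (real \<times> real) measure set" where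
  "couplings \<mu> \<nu> =
     {\<pi>. prob_space \<pi> \<and> sets \<pi> = sets borel \<and> distr \<pi> borel fst = \<mu> \<and> distr \<pi> borel snd = \<nu>}"

text \<open>Powers of extended nonnegative reals, for exponents \<open>p > 0\<close>. Transport costs are valued in
  \<open>ennreal\<close> so that non-integrable couplings cost \<open>\<infinity>\<close>.\<close>

definition epowr :: "ennreal \<Rightarrow> real \<Rightarrow> ennreal" where
  "epowr x p = (if x = \<infinity> then \<infinity> else ennreal (enn2real x powr p))"

definition wasserstein :: "real \<Rightarrow> real measure \<Rightarrow> real measure \<Rightarrow> ennreal" where
  "wasserstein r \<mu> \<nu> =
     (INF \<pi>\<in>couplings \<mu> \<nu>. epowr (\<integral>\<^sup>+ (u, v). ennreal (\<bar>u - v\<bar> powr r) \<partial>\<pi>) (1 / r))"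

definition max_sliced_wasserstein ::
  "real \<Rightarrow> ('a::euclidean_space \<Rightarrow> real) \<Rightarrow> 'a measure \<Rightarrow> 'a measure \<Rightarrow> ennreal" where
  "max_sliced_wasserstein r N P Q =
     (SUP \<gamma>\<in>{\<gamma>. N \<gamma> = 1}. wasserstein r (sliced \<gamma> P) (sliced \<gamma> Q))"

end

theory Submission
  imports Defs
begin

text \<open>
  Almost surely the sample lies in the support, whose projection in a direction \<open>\<gamma>\<close> with \<open>N \<gamma> = 1\<close> is contained in an
  interval of length \<open>D\<close>, the dual diameter (\<open>inner_diff_le_norm_diam\<close>). On such an interval \<open>\<bar>u - v\<bar> powr r\<close> is at most
  \<open>D powr (r - 1) * \<bar>u - v\<bar>\<close>; the quantile coupling has mean displacement equal to the area between the distribution functions,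
  and that area is a difference of integrals of one \<open>1\<close>-Lipschitz function (\<open>wasserstein_le_lipschitz_dual\<close>). So it suffices to
  bound, uniformly in \<open>\<gamma>\<close> and in the \<open>1\<close>-Lipschitz function \<open>f\<close>, the deviation of the empirical from the true mean of
  \<open>z \<mapsto> f (z \<bullet> \<gamma>)\<close> by a multiple of \<open>D / sqrt n\<close>.

  This class has small entropy in the uniform norm over the support. At relative precision \<open>\<epsilon>\<close> the profiles \<open>f\<close> need
  \<open>exp (O (1 / \<epsilon>))\<close> functions (\<open>lipschitz_pinned_net\<close>) and the directions, by comparing volumes of balls of \<open>N\<close>, at most
  \<open>(1 + 2 / \<epsilon>) ^ (d + 1)\<close> (\<open>is_norm_sphere_net\<close>). The square root of the entropy is integrable at \<open>\<epsilon> = 0\<close>, so chaining through nets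
  of precision \<open>4 ^ - (k + 1)\<close>, with Hoeffding's inequality on each link, gives the rate \<open>1 / sqrt n\<close> without a logarithmic factor
  (\<open>chaining_deviation_bound\<close>, \<open>lipschitz_ridge_deviation\<close>). The failure probability is divided among the levels, so the bound holds
  with probability \<open>1 - \<alpha>\<close> directly, and the oscillations of the links sum to at most \<open>2 D\<close>, which accounts for the term
  \<open>sqrt (2 * ln (1 / \<alpha>))\<close>.

  It remains to see that the set whose measure is asserted is an event at all, since it involves an uncountable supremum over
  directions of infima over couplings. For each direction the distance is lower semicontinuous in the sample points
  (\<open>closed_wasserstein_empirical_le\<close>), because a coupling follows when the atoms of an empirical measure are moved; hence
  the sublevel sets of the supremum are closed.
\<close>

section \<open>Powers of extended reals\<close>

lemma epowr_le_iff:
  assumes "p > 0" shows "epowr x p \<le> epowr y p \<longleftrightarrow> x \<le> y"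
proof (cases x; cases y)
  fix a b :: real assume "x = ennreal a" "0 \<le> a" "y = ennreal b" "0 \<le> b"
  then show ?thesis using assms
    by (auto simp: epowr_def intro: powr_mono2) (meson assms not_le powr_less_mono2)
qed (auto simp: epowr_def top_unique)

lemma epowr_epowr_inverse:
  assumes "p > 0" "q = 1 / p" shows "epowr (epowr x p) q = x"
  using assms by (cases x) (auto simp: epowr_def powr_powr)

lemma epowr_le_ennreal_iff:
  assumes "p > 0" "0 \<le> c"
  shows "epowr x p \<le> ennreal c \<longleftrightarrow> x \<le> ennreal (c powr (1 / p))"
proof -
  have "ennreal c = epowr (ennreal (c powr (1 / p))) p"
    using assms by (simp add: epowr_def powr_powr)
  then show ?thesis using epowr_le_iff[OF assms(1)] by metis
qed

text \<open>For a positive exponent \<open>epowr\<close> is an order isomorphism, so it passes through the infimum over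
  couplings. Thus the root in the definition of the distance can be traded for a power of the bound.\<close>

lemma epowr_INF:
  assumes "p > 0" shows "epowr (INF x\<in>A. f x) p = (INF x\<in>A. epowr (f x) p)"
proof (rule antisym)
  show "epowr (INF x\<in>A. f x) p \<le> (INF x\<in>A. epowr (f x) p)"
    using assms by (intro INF_greatest) (simp add: epowr_le_iff INF_lower)
  have "epowr (INF x\<in>A. epowr (f x) p) (1 / p) \<le> f x" if "x \<in> A" for x
    using epowr_le_iff[of "1 / p" "INF x\<in>A. epowr (f x) p" "epowr (f x) p"]
      INF_lower[OF that, of "\<lambda>x. epowr (f x) p"] assms
    by (simp add: epowr_epowr_inverse del: INF_lower)
  then have "epowr (INF x\<in>A. epowr (f x) p) (1 / p) \<le> (INF x\<in>A. f x)"
    by (rule INF_greatest)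
  then show "(INF x\<in>A. epowr (f x) p) \<le> epowr (INF x\<in>A. f x) p"
    using assms epowr_le_iff[OF assms, of "epowr (INF x\<in>A. epowr (f x) p) (1 / p)"]
    by (simp add: epowr_epowr_inverse)
qed

lemma wasserstein_le_iff:
  assumes "r > 0" "c \<ge> 0"
  shows "wasserstein r \<mu> \<nu> \<le> ennreal c \<longleftrightarrow>
    (INF \<pi>\<in>couplings \<mu> \<nu>. \<integral>\<^sup>+ (u, v). ennreal (\<bar>u - v\<bar> powr r) \<partial>\<pi>) \<le> ennreal (c powr r)"
  unfolding wasserstein_def using assms
  by (subst epowr_INF[symmetric]) (auto simp: epowr_le_ennreal_iff)


section \<open>Empirical measures and projections\<close>

lemma sets_empirical_measure [simp, measurable_cong]: "sets (empirical_measure n x) = sets borel"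
  by (simp add: empirical_measure_def)

lemma prob_space_empirical_measure: "n > 0 \<Longrightarrow> prob_space (empirical_measure n x)"
  unfolding empirical_measure_def
  by (intro prob_space.prob_space_distr prob_space_uniform_count_measure)
     (auto simp: measurable_def space_uniform_count_measure sets_uniform_count_measure)

lemma integral_empirical_measure:
  fixes f :: "'a::topological_space \<Rightarrow> real"
  assumes n: "n > 0" and f: "f \<in> borel_measurable borel"
  shows "(\<integral>z. f z \<partial>empirical_measure n x) = (\<Sum>i<n. f (x i)) / n"
proof -
  have "(\<integral>z. f z \<partial>empirical_measure n x) = (\<integral>i. f (x i) \<partial>uniform_count_measure {..<n})"
    unfolding empirical_measure_def using f
    by (intro integral_distr) (auto simp: measurable_def space_uniform_count_measure sets_uniform_count_measure)
  also have "\<dots> = (\<Sum>i<n. f (x i)) / n"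
    by (simp add: integral_uniform_count_measure)
  finally show ?thesis .
qed

lemma AE_empirical_measure:
  assumes "n > 0" "\<And>i. i < n \<Longrightarrow> x i \<in> A" "A \<in> sets borel"
  shows "AE z in empirical_measure n x. z \<in> A"
proof (rule AE_I')
  have "{i \<in> {..<n}. x i \<in> - A} = {}" using assms(2) by auto
  then have "emeasure (empirical_measure n x) (- A) = 0"
    using assms(1,3) by (subst emeasure_empirical_measure) auto
  then show "- A \<in> null_sets (empirical_measure n x)"
    using assms(3) by (auto simp: null_sets_def empirical_measure_def)
qed auto

lemma empirical_measure_cong:
  assumes "\<And>i. i < n \<Longrightarrow> x i = y i"
  shows "empirical_measure n x = empirical_measure n y"
  unfolding empirical_measure_def
  by (rule distr_cong) (simp_all add: space_uniform_count_measure assms)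

lemma sliced_empirical_measure:
  "sliced \<gamma> (empirical_measure n x) = empirical_measure n (\<lambda>i. x i \<bullet> \<gamma>)"
  unfolding sliced_def empirical_measure_def
  by (subst distr_distr) (simp_all add: o_def measurable_def[of "uniform_count_measure _"]
      space_uniform_count_measure sets_uniform_count_measure)

lemma real_distribution_sliced:
  assumes "prob_space Q" "sets Q = sets borel"
  shows "real_distribution (sliced \<gamma> Q)"
proof -
  have "(\<lambda>z. z \<bullet> \<gamma>) \<in> Q \<rightarrow>\<^sub>M borel"
    by (subst measurable_cong_sets[OF assms(2) refl]) simp
  then interpret prob_space "sliced \<gamma> Q"
    unfolding sliced_def by (rule prob_space.prob_space_distr[OF assms(1)])
  show ?thesis by unfold_locales (simp_all add: sliced_def)
qed

lemma AE_sliced: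
  assumes "sets Q = sets borel" "AE z in Q. z \<in> S" "\<And>z. z \<in> S \<Longrightarrow> z \<bullet> \<gamma> \<in> {a..b}"
  shows "AE t in sliced \<gamma> Q. t \<in> {a..b}"
proof -
  have m: "(\<lambda>z. z \<bullet> \<gamma>) \<in> Q \<rightarrow>\<^sub>M borel"
    by (subst measurable_cong_sets[OF assms(1) refl]) simp
  have "AE z in Q. z \<bullet> \<gamma> \<in> {a..b}" using assms(2) by eventually_elim (rule assms(3))
  then show ?thesis unfolding sliced_def by (subst AE_distr_iff[OF m]) auto
qed

lemma integral_sliced:
  fixes f :: "real \<Rightarrow> real"
  assumes "sets Q = sets borel" "f \<in> borel_measurable borel"
  shows "(\<integral>t. f t \<partial>sliced \<gamma> Q) = (\<integral>z. f (z \<bullet> \<gamma>) \<partial>Q)"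
proof -
  have m: "(\<lambda>z. z \<bullet> \<gamma>) \<in> Q \<rightarrow>\<^sub>M borel"
    by (subst measurable_cong_sets[OF assms(1) refl]) simp
  show ?thesis unfolding sliced_def by (rule integral_distr[OF m assms(2)])
qed


section \<open>Semicontinuity in the sample points\<close>

text \<open>Convexity of the power, applied to \<open>a + b\<close> as the \<open>l\<close>-weighted mean of \<open>a / l\<close> and
  \<open>b / (1 - l)\<close>. With \<open>l\<close> near \<open>1\<close> it says that a small perturbation \<open>b\<close> changes the cost little; it takes the place of
  Minkowski's inequality in \<open>L\<^sup>r\<close>.\<close>

lemma powr_add_le_split:
  fixes a b r l :: real
  assumes "r \<ge> 1" "0 < l" "l < 1" "a \<ge> 0" "b \<ge> 0"
  shows "(a + b) powr r \<le> l powr (1 - r) * a powr r + (1 - l) powr (1 - r) * b powr r"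
proof -
  have ge1: "c \<le> m powr (1 - r) * c" if "0 < m" "m < 1" "c \<ge> 0" for m c :: real
  proof -
    have "1 \<le> m powr (1 - r)"
      using that assms(1) powr_mono'[of "1 - r" 0 m] by simp
    then show ?thesis using mult_right_mono[of 1 _ c] that by simp
  qed
  consider "a = 0" | "b = 0" | "a > 0" "b > 0" using assms by linarith
  then show ?thesis
  proof cases
    case 3
    have "(l *\<^sub>R (a / l) + (1 - l) *\<^sub>R (b / (1 - l))) powr r \<le> l * (a / l) powr r + (1 - l) * (b / (1 - l)) powr r"
      using convex_onD[OF powr_convex[OF assms(1)], of "1-l" "a/l" "b/(1-l)"] assms 3 by simp
    also have "l *\<^sub>R (a / l) + (1 - l) *\<^sub>R (b / (1 - l)) = a + b"
      using assms by simp
    also have "l * (a / l) powr r = l powr (1 - r) * a powr r"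
      using assms by (simp add: powr_divide powr_diff)
    also have "(1 - l) * (b / (1 - l)) powr r = (1 - l) powr (1 - r) * b powr r"
      using assms by (simp add: powr_divide powr_diff)
    finally show ?thesis .
  qed (use ge1[of l "a powr r"] ge1[of "1 - l" "b powr r"] assms in auto)
qed

text \<open>A point \<open>(u, v)\<close> drawn from \<open>\<pi>\<close> with \<open>u\<close> an atom is given an index \<open>i\<close>, uniform among those with
  \<open>y i = u\<close>, and is then moved to \<open>(y' i, v)\<close>. The uniform choice is the disintegration of \<open>\<pi>\<close> over its discrete
  first marginal; it is what allows coinciding atoms to be moved apart.\<close>

lemma nn_integral_move_atoms:
  fixes n :: nat and y y' :: "nat \<Rightarrow> real" and \<pi> :: "(real \<times> real) measure"
  assumes "prob_space \<pi>" and [measurable_cong]: "sets \<pi> = sets borel"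
  defines "w \<equiv> \<lambda>i u. if u = y i then ennreal (1 / real (card {j\<in>{..<n}. y j = y i})) else 0"
  obtains \<pi>' where "sets \<pi>' = sets borel"
    "\<And>g. g \<in> borel_measurable borel \<Longrightarrow>
       (\<integral>\<^sup>+p. g p \<partial>\<pi>') = (\<integral>\<^sup>+p. (\<Sum>i<n. w i (fst p) * g (y' i, snd p)) \<partial>\<pi>)"
proof -
  interpret pi: prob_space \<pi> by fact
  have [measurable_cong]: "sets \<pi> = sets ((borel :: real measure) \<Otimes>\<^sub>M (borel :: real measure))"
    unfolding borel_prod by (rule assms)
  have [measurable]: "(\<lambda>p. w i (fst p)) \<in> borel_measurable \<pi>" for i
    unfolding w_def by measurable
  have [measurable]: "(\<lambda>(i, p). w i (fst p)) \<in> borel_measurable (count_space {..<n} \<Otimes>\<^sub>M \<pi>)"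
    by (rule measurable_pair_measure_countable1) simp_all
  have [measurable]: "(\<lambda>p. (y' i, snd p)) \<in> \<pi> \<rightarrow>\<^sub>M borel" for i
    unfolding borel_prod[symmetric] by measurable
  have [measurable]: "(\<lambda>(i, p). (y' i, snd p)) \<in> count_space {..<n} \<Otimes>\<^sub>M \<pi> \<rightarrow>\<^sub>M borel"
    by (rule measurable_pair_measure_countable1) simp_all
  define \<pi>' where "\<pi>' = distr (density (count_space {..<n} \<Otimes>\<^sub>M \<pi>) (\<lambda>(i, p). w i (fst p))) borel (\<lambda>(i, p). (y' i, snd p))"
  show ?thesis
  proof
    show "sets \<pi>' = sets borel" by (simp add: \<pi>'_def)
    fix g :: "real \<times> real \<Rightarrow> ennreal" assume [measurable]: "g \<in> borel_measurable borel"
    have "(\<integral>\<^sup>+p. g p \<partial>\<pi>') = (\<integral>\<^sup>+q. (case q of (i, p) \<Rightarrow> w i (fst p)) * g (case q of (i, p) \<Rightarrow> (y' i, snd p)) \<partial>(count_space {..<n} \<Otimes>\<^sub>M \<pi>))"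
      unfolding \<pi>'_def by (subst nn_integral_distr) (simp_all add: nn_integral_density)
    also have "\<dots> = (\<integral>\<^sup>+i. (\<integral>\<^sup>+p. w i (fst p) * g (y' i, snd p) \<partial>\<pi>) \<partial>count_space {..<n})"
      using pi.nn_integral_fst[of "\<lambda>(i, p). w i (fst p) * g (y' i, snd p)" "count_space {..<n}"]
      by (simp add: case_prod_unfold)
    also have "\<dots> = (\<Sum>i<n. \<integral>\<^sup>+p. w i (fst p) * g (y' i, snd p) \<partial>\<pi>)"
      by (simp add: nn_integral_count_space_finite)
    also have "\<dots> = (\<integral>\<^sup>+p. (\<Sum>i<n. w i (fst p) * g (y' i, snd p)) \<partial>\<pi>)"
      by (subst nn_integral_sum) simp_all
    finally show "(\<integral>\<^sup>+p. g p \<partial>\<pi>') = (\<integral>\<^sup>+p. (\<Sum>i<n. w i (fst p) * g (y' i, snd p)) \<partial>\<pi>)" .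
  qed
qed

lemma emeasure_distr_nn_integral:
  "h \<in> Q \<rightarrow>\<^sub>M R \<Longrightarrow> A \<in> sets R \<Longrightarrow> emeasure (distr Q R h) A = (\<integral>\<^sup>+p. indicator A (h p) \<partial>Q)"
  using nn_integral_distr[of h Q R "indicator A"] by simp

text \<open>Moving the atoms of an empirical measure by at most \<open>\<eta>\<close> carries a coupling along, at a cost that
  is controlled uniformly in the coupling.\<close>

lemma coupling_move_atoms:
  fixes y y' :: "nat \<Rightarrow> real"
  assumes n: "n > 0" and r: "r \<ge> 1" and l: "0 < l" "l < 1" and \<eta>: "\<And>i. i < n \<Longrightarrow> \<bar>y' i - y i\<bar> \<le> \<eta>"
    and \<pi>: "\<pi> \<in> couplings (empirical_measure n y) \<nu>"
  obtains \<pi>' where "\<pi>' \<in> couplings (empirical_measure n y') \<nu>"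
    "(\<integral>\<^sup>+ (u, v). ennreal (\<bar>u - v\<bar> powr r) \<partial>\<pi>') \<le>
       ennreal (l powr (1 - r)) * (\<integral>\<^sup>+ (u, v). ennreal (\<bar>u - v\<bar> powr r) \<partial>\<pi>)
       + ennreal ((1 - l) powr (1 - r) * \<eta> powr r)"
proof -
  have sb [measurable_cong]: "sets \<pi> = sets borel" and "prob_space \<pi>" 
    and m1: "distr \<pi> borel fst = empirical_measure n y" and m2: "distr \<pi> borel snd = \<nu>"
    using \<pi> by (auto simp: couplings_def)
  interpret prob_space \<pi> by fact
  have sbb [measurable_cong]: "sets \<pi> = sets ((borel :: real measure) \<Otimes>\<^sub>M (borel :: real measure))" unfolding borel_prod by (rule sb)
  define m where "m i = card {j\<in>{..<n}. y j = y i}" for i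
  define w where "w i u = (if u = y i then ennreal (1 / real (m i)) else 0)" for i u
  obtain \<pi>' where sb' [measurable_cong]: "sets \<pi>' = sets borel" and int: 
    "\<And>g. g \<in> borel_measurable borel \<Longrightarrow>
       (\<integral>\<^sup>+p. g p \<partial>\<pi>') = (\<integral>\<^sup>+p. (\<Sum>i<n. w i (fst p) * g (y' i, snd p)) \<partial>\<pi>)"
    unfolding w_def m_def by (rule nn_integral_move_atoms[OF \<open>prob_space \<pi>\<close> sb, where n=n and y=y and y'=y']) blast
  have sbb' [measurable_cong]: "sets \<pi>' = sets ((borel :: real measure) \<Otimes>\<^sub>M (borel :: real measure))" unfolding borel_prod by (rule sb')
  have [measurable]: "w i \<in> borel_measurable borel" for i unfolding w_def by measurable
  have mpos: "m i > 0" if "i < n" for i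
    using that by (auto simp: m_def card_gt_0_iff)
  have wsum: "(\<Sum>i<n. w i u) = 1" if u: "u \<in> y ` {..<n}" for u
  proof -
    obtain k where k: "k < n" "u = y k" using u by auto
    have "(\<Sum>i<n. w i u) = (\<Sum>i\<in>{j\<in>{..<n}. y j = y k}. ennreal (1 / real (m k)))"
      unfolding w_def k by (rule sum.mono_neutral_cong_right) (auto simp: m_def)
    also have "\<dots> = of_nat (m k) * ennreal (1 / real (m k))"
      by (simp add: m_def)
    also have "\<dots> = 1" using mpos[OF k(1)]
      by (simp add: ennreal_of_nat_eq_real_of_nat flip: ennreal_mult)
    finally show ?thesis .
  qed
  \<comment> \<open>The weights form a partition of unity only on the atoms, which carry the first marginal.\<close>
  have "AE u in distr \<pi> borel fst. u \<in> y ` {..<n}"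
    unfolding m1
  proof (rule AE_I')
    show "- (y ` {..<n}) \<in> null_sets (empirical_measure n y)"
      using n by (auto simp: null_sets_def emeasure_empirical_measure finite_imp_closed)
  qed auto
  then have AEy: "AE p in \<pi>. fst p \<in> y ` {..<n}"
    by (rule AE_distrD[rotated]) simp
  have atom: "emeasure \<pi> {p\<in>space \<pi>. fst p = y i} = ennreal (real (m i) / n)" for i
  proof -
    have "emeasure \<pi> {p\<in>space \<pi>. fst p = y i} = emeasure (distr \<pi> borel fst) {y i}"
      by (subst emeasure_distr) (auto intro!: arg_cong[where f="emeasure \<pi>"])
    also have "\<dots> = ennreal (real (m i) / n)"
      unfolding m1 using n by (simp add: emeasure_empirical_measure m_def)
    finally show ?thesis .
  qed
  have fst': "distr \<pi>' borel fst = empirical_measure n y'"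
  proof (rule measure_eqI)
    fix A :: "real set" assume "A \<in> sets (distr \<pi>' borel fst)"
    then have A [measurable]: "A \<in> sets borel" by simp
    have "emeasure (distr \<pi>' borel fst) A = (\<integral>\<^sup>+p. indicator A (fst p) \<partial>\<pi>')"
      by (rule emeasure_distr_nn_integral) simp_all
    also have "\<dots> = (\<integral>\<^sup>+p. (\<Sum>i<n. w i (fst p) * indicator A (y' i)) \<partial>\<pi>)"
      by (subst int) (simp_all flip: borel_prod)
    also have "\<dots> = (\<Sum>i<n. (\<integral>\<^sup>+p. w i (fst p) \<partial>\<pi>) * indicator A (y' i))"
      by (subst nn_integral_sum) (simp_all add: nn_integral_multc)
    also have "\<dots> = (\<Sum>i<n. ennreal (1 / n) * indicator A (y' i))"
    proof (intro sum.cong refl arg_cong2[where f="(*)"])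
      fix i assume i: "i \<in> {..<n}"
      have "(\<integral>\<^sup>+p. w i (fst p) \<partial>\<pi>) = (\<integral>\<^sup>+p. ennreal (1 / real (m i)) * indicator {p\<in>space \<pi>. fst p = y i} p \<partial>\<pi>)"
        by (rule nn_integral_cong) (auto simp: w_def indicator_def)
      also have "\<dots> = ennreal (1 / n)"
        using mpos[of i] i by (subst nn_integral_cmult_indicator) (simp_all add: atom flip: ennreal_mult)
      finally show "(\<integral>\<^sup>+p. w i (fst p) \<partial>\<pi>) = ennreal (1 / n)" .
    qed
    also have "\<dots> = (\<Sum>i\<in>{i\<in>{..<n}. y' i \<in> A}. ennreal (1 / n))"
      by (rule sum.mono_neutral_cong_right) (auto simp: indicator_def)
    also have "\<dots> = ennreal (card {i\<in>{..<n}. y' i \<in> A} / n)"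
      by (simp add: ennreal_of_nat_eq_real_of_nat flip: ennreal_mult)
    also have "\<dots> = emeasure (empirical_measure n y') A"
      using n by (simp add: emeasure_empirical_measure)
    finally show "emeasure (distr \<pi>' borel fst) A = emeasure (empirical_measure n y') A" .
  qed simp
  have snd': "distr \<pi>' borel snd = \<nu>"
  proof -
    have "distr \<pi>' borel snd = distr \<pi> borel snd"
    proof (rule measure_eqI)
      fix A :: "real set" assume "A \<in> sets (distr \<pi>' borel snd)"
      then have A [measurable]: "A \<in> sets borel" by simp
      have "emeasure (distr \<pi>' borel snd) A = (\<integral>\<^sup>+p. indicator A (snd p) \<partial>\<pi>')"
        by (rule emeasure_distr_nn_integral) simp_all
      also have "\<dots> = (\<integral>\<^sup>+p. (\<Sum>i<n. w i (fst p) * indicator A (snd p)) \<partial>\<pi>)"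
        by (subst int) (simp_all flip: borel_prod)
      also have "\<dots> = (\<integral>\<^sup>+p. indicator A (snd p) \<partial>\<pi>)"
        by (rule nn_integral_cong_AE, use AEy in eventually_elim)
           (simp add: wsum flip: sum_distrib_right)
      also have "\<dots> = emeasure (distr \<pi> borel snd) A"
        by (rule emeasure_distr_nn_integral[symmetric]) simp_all
      finally show "emeasure (distr \<pi>' borel snd) A = emeasure (distr \<pi> borel snd) A" .
    qed simp
    then show ?thesis using m2 by simp
  qed
  have "prob_space \<pi>'"
  proof (rule prob_space_distrD)
    show "fst \<in> \<pi>' \<rightarrow>\<^sub>M (borel :: real measure)" by simp
    show "prob_space (distr \<pi>' borel fst)"
      unfolding fst' by (rule prob_space_empirical_measure[OF n])
  qed
  \<comment> \<open>Cost: on the mass assigned to index \<open>i\<close> the first coordinate moved from \<open>y i\<close> to \<open>y' i\<close>, by at most \<open>\<eta>\<close>.\<close>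
  define K where "K = ennreal (l powr (1 - r))"
  define E where "E = ennreal ((1 - l) powr (1 - r) * \<eta> powr r)"
  have "(\<integral>\<^sup>+ (u, v). ennreal (\<bar>u - v\<bar> powr r) \<partial>\<pi>') = 
      (\<integral>\<^sup>+p. (\<Sum>i<n. w i (fst p) * ennreal (\<bar>y' i - snd p\<bar> powr r)) \<partial>\<pi>)"
    by (subst int) (simp_all add: split_beta flip: borel_prod)
  also have "\<dots> \<le> (\<integral>\<^sup>+p. K * ennreal (\<bar>fst p - snd p\<bar> powr r) + E \<partial>\<pi>)"
  proof (rule nn_integral_mono_AE, use AEy in eventually_elim)
    fix p :: "real \<times> real" assume p: "fst p \<in> y ` {..<n}"
    have "(\<Sum>i<n. w i (fst p) * ennreal (\<bar>y' i - snd p\<bar> powr r))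
         \<le> (\<Sum>i<n. w i (fst p) * (K * ennreal (\<bar>fst p - snd p\<bar> powr r) + E))"
    proof (rule sum_mono)
      fix i assume i: "i \<in> {..<n}"
      show "w i (fst p) * ennreal (\<bar>y' i - snd p\<bar> powr r)
          \<le> w i (fst p) * (K * ennreal (\<bar>fst p - snd p\<bar> powr r) + E)"
      proof (cases "fst p = y i")
        case True
        have "\<bar>y' i - snd p\<bar> powr r \<le> (\<bar>y i - snd p\<bar> + \<eta>) powr r"
          using \<eta>[of i] i r by (intro powr_mono2) auto
        also have "\<dots> \<le> l powr (1 - r) * \<bar>y i - snd p\<bar> powr r + (1 - l) powr (1 - r) * \<eta> powr r"
          using r l \<eta>[of i] i by (intro powr_add_le_split) auto
        finally have "ennreal (\<bar>y' i - snd p\<bar> powr r) \<le> K * ennreal (\<bar>fst p - snd p\<bar> powr r) + E"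
          unfolding K_def E_def True by (simp flip: ennreal_mult ennreal_plus add: ennreal_leI)
        then show ?thesis by (intro mult_left_mono) auto
      qed (simp add: w_def)
    qed
    also have "\<dots> = K * ennreal (\<bar>fst p - snd p\<bar> powr r) + E"
      using wsum[OF p] by (simp flip: sum_distrib_right)
    finally show "(\<Sum>i<n. w i (fst p) * ennreal (\<bar>y' i - snd p\<bar> powr r))
         \<le> K * ennreal (\<bar>fst p - snd p\<bar> powr r) + E" .
  qed
  also have "\<dots> = K * (\<integral>\<^sup>+ (u, v). ennreal (\<bar>u - v\<bar> powr r) \<partial>\<pi>) + E"
  proof -
    have "(\<integral>\<^sup>+p. K * ennreal (\<bar>fst p - snd p\<bar> powr r) + E \<partial>\<pi>)
      = (\<integral>\<^sup>+p. K * ennreal (\<bar>fst p - snd p\<bar> powr r) \<partial>\<pi>) + (\<integral>\<^sup>+p. E \<partial>\<pi>)"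
      by (rule nn_integral_add) simp_all
    also have "(\<integral>\<^sup>+p. E \<partial>\<pi>) = E" by (simp add: emeasure_space_1)
    also have "(\<integral>\<^sup>+p. K * ennreal (\<bar>fst p - snd p\<bar> powr r) \<partial>\<pi>)
      = K * (\<integral>\<^sup>+p. ennreal (\<bar>fst p - snd p\<bar> powr r) \<partial>\<pi>)"
      by (rule nn_integral_cmult) simp
    finally show ?thesis unfolding case_prod_unfold .
  qed
  finally have "(\<integral>\<^sup>+ (u, v). ennreal (\<bar>u - v\<bar> powr r) \<partial>\<pi>')
     \<le> K * (\<integral>\<^sup>+ (u, v). ennreal (\<bar>u - v\<bar> powr r) \<partial>\<pi>) + E" .
  moreover have "\<pi>' \<in> couplings (empirical_measure n y') \<nu>"
    using \<open>prob_space \<pi>'\<close> sb' fst' snd' by (simp add: couplings_def)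
  ultimately show ?thesis using that unfolding K_def E_def by blast
qed

text \<open>The distance to a fixed law is lower semicontinuous in the sample points, for the product topology.
  Sublevel sets of the supremum over all directions are intersections of such closed sets; this is how the uncountable
  supremum causes no measurability problem.\<close>

lemma closed_wasserstein_empirical_le:
  assumes n: "n > 0" and r: "r \<ge> 1" and c: "c \<ge> 0"
  shows "closed {y. wasserstein r (empirical_measure n y) \<nu> \<le> ennreal c}"
  unfolding closed_sequential_limits
proof (intro allI impI)
  fix Y :: "nat \<Rightarrow> nat \<Rightarrow> real" and y
  define T where "T z = (INF \<pi>\<in>couplings (empirical_measure n z) \<nu>. \<integral>\<^sup>+ (u, v). ennreal (\<bar>u - v\<bar> powr r) \<partial>\<pi>)" for z
  assume A: "(\<forall>k. Y k \<in> {y. wasserstein r (empirical_measure n y) \<nu> \<le> ennreal c}) \<and> Y \<longlonglongrightarrow> y"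
  have T_iff: "wasserstein r (empirical_measure n z) \<nu> \<le> ennreal c \<longleftrightarrow> T z \<le> ennreal (c powr r)" for z
    unfolding T_def using r c by (intro wasserstein_le_iff) auto
  have TY: "T (Y k) \<le> ennreal (c powr r)" for k using A T_iff by auto
  have conv: "(\<lambda>k. Y k i) \<longlonglongrightarrow> y i" for i
  proof -
    have "isCont (\<lambda>z::nat \<Rightarrow> real. z i) y"
      by (rule continuous_on_interior[OF continuous_on_product_coordinates]) simp
    then show ?thesis by (rule isCont_tendsto_compose) (use A in blast)
  qed
  define \<eta> where "\<eta> k = (\<Sum>i<n. \<bar>y i - Y k i\<bar>)" for k
  have \<eta>0: "\<eta> \<longlonglongrightarrow> 0"
  proof -
    have "(\<lambda>k. \<Sum>i<n. \<bar>y i - Y k i\<bar>) \<longlonglongrightarrow> (\<Sum>i<n. \<bar>y i - y i\<bar>)"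
      by (intro tendsto_intros conv)
    then show ?thesis by (simp add: \<eta>_def[abs_def])
  qed
  \<comment> \<open>Perturbing a nearly optimal coupling for \<open>Y k\<close>; then \<open>k \<rightarrow> \<infinity>\<close>, \<open>l \<rightarrow> 1\<close> and \<open>B \<rightarrow> c powr r\<close>, in this order.\<close>
  have step: "T y \<le> ennreal (l powr (1 - r) * B + (1 - l) powr (1 - r) * \<eta> k powr r)"
    if l: "0 < l" "l < 1" and B: "c powr r < B" for l B k
  proof -
    have B0: "0 \<le> B" using B powr_ge_zero[of c r] by linarith
    then have "T (Y k) < ennreal B"
      using TY[of k] B by (meson ennreal_less_iff le_less_trans powr_ge_zero)
    then obtain \<pi> where \<pi>: "\<pi> \<in> couplings (empirical_measure n (Y k)) \<nu>"
      "(\<integral>\<^sup>+ (u, v). ennreal (\<bar>u - v\<bar> powr r) \<partial>\<pi>) < ennreal B"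
      unfolding T_def INF_less_iff by blast
    have "\<bar>y i - Y k i\<bar> \<le> \<eta> k" if "i < n" for i
      unfolding \<eta>_def using that member_le_sum[of i "{..<n}" "\<lambda>i. \<bar>y i - Y k i\<bar>"] by auto
    then obtain \<pi>' where "\<pi>' \<in> couplings (empirical_measure n y) \<nu>" 
      and "(\<integral>\<^sup>+ (u, v). ennreal (\<bar>u - v\<bar> powr r) \<partial>\<pi>') \<le>
       ennreal (l powr (1 - r)) * (\<integral>\<^sup>+ (u, v). ennreal (\<bar>u - v\<bar> powr r) \<partial>\<pi>)
       + ennreal ((1 - l) powr (1 - r) * \<eta> k powr r)"
      by (rule coupling_move_atoms[OF n r l _ \<pi>(1)]) blast
    then have "T y \<le> ennreal (l powr (1 - r)) * (\<integral>\<^sup>+ (u, v). ennreal (\<bar>u - v\<bar> powr r) \<partial>\<pi>)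
       + ennreal ((1 - l) powr (1 - r) * \<eta> k powr r)"
      unfolding T_def by (intro INF_lower2)
    also have "\<dots> \<le> ennreal (l powr (1 - r)) * ennreal B + ennreal ((1 - l) powr (1 - r) * \<eta> k powr r)"
      using \<pi>(2) by (intro add_mono mult_left_mono) auto
    finally show ?thesis using B0 by (simp flip: ennreal_mult ennreal_plus)
  qed
  have l_bound: "T y \<le> ennreal (l powr (1 - r) * B)" if l: "0 < l" "l < 1" and B: "c powr r < B" for l B
  proof -
    have "(\<lambda>k. l powr (1 - r) * B + (1 - l) powr (1 - r) * \<eta> k powr r)
        \<longlonglongrightarrow> l powr (1 - r) * B + (1 - l) powr (1 - r) * 0 powr r"
      using r by (intro tendsto_intros \<eta>0 tendsto_powr') (auto simp: \<eta>_def sum_nonneg)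
    then have "(\<lambda>k. ennreal (l powr (1 - r) * B + (1 - l) powr (1 - r) * \<eta> k powr r))
       \<longlonglongrightarrow> ennreal (l powr (1 - r) * B)"
      by (intro tendsto_ennrealI) simp
    from LIMSEQ_le_const[OF this, of "T y"] step[OF l B] show ?thesis by blast
  qed
  have B_bound: "T y \<le> ennreal B" if B: "c powr r < B" for B
  proof (rule tendsto_lowerbound)
    have "((\<lambda>l::real. l powr (1 - r) * B) \<longlongrightarrow> 1 powr (1 - r) * B) (at_left 1)"
      by (intro tendsto_intros) auto
    then show "((\<lambda>l. ennreal (l powr (1 - r) * B)) \<longlongrightarrow> ennreal B) (at_left 1)"
      using tendsto_ennrealI by fastforce
    show "\<forall>\<^sub>F l in at_left 1. T y \<le> ennreal (l powr (1 - r) * B)"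
      unfolding eventually_at_left[OF zero_less_one] using l_bound B zero_less_one by blast
  qed simp
  have "T y \<le> ennreal (c powr r)"
  proof (rule ennreal_le_epsilon)
    fix e :: real assume "0 < e"
    then show "T y \<le> ennreal (c powr r) + ennreal e"
      using B_bound[of "c powr r + e"] ennreal_plus[of "c powr r" e] by simp
  qed
  then show "y \<in> {y. wasserstein r (empirical_measure n y) \<nu> \<le> ennreal c}" using T_iff by auto
qed

lemma max_sliced_wasserstein_le_iff:
  assumes r: "r \<ge> 1" and c: "c \<ge> 0"
  shows "epowr (max_sliced_wasserstein r N Q P) r \<le> ennreal c \<longleftrightarrow>
    (\<forall>\<gamma>. N \<gamma> = 1 \<longrightarrow> epowr (wasserstein r (sliced \<gamma> Q) (sliced \<gamma> P)) r \<le> ennreal c)"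
  using assms by (simp add: epowr_le_ennreal_iff max_sliced_wasserstein_def SUP_le_iff)

text \<open>The event is the preimage, under the sample, of an intersection of closed sets indexed by the directions.\<close>

lemma max_sliced_wasserstein_event_measurable:
  fixes X :: "nat \<Rightarrow> 'w \<Rightarrow> 'a::euclidean_space"
  assumes r: "r \<ge> 1" and c: "c \<ge> 0" and n: "n > 0" and X: "\<And>i. i < n \<Longrightarrow> X i \<in> M \<rightarrow>\<^sub>M borel"
  shows "{\<omega>\<in>space M. epowr (max_sliced_wasserstein r N (empirical_measure n (\<lambda>i. X i \<omega>)) P) r \<le> ennreal c} \<in> sets M"
proof -
  define Y where "Y \<omega> i = (if i < n then X i \<omega> else 0)" for \<omega> i
  have "Y \<in> M \<rightarrow>\<^sub>M borel"
  proof (rule measurable_coordinatewise_then_product)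
    fix i show "(\<lambda>\<omega>. Y \<omega> i) \<in> borel_measurable M"
      by (cases "i < n") (simp_all add: Y_def X)
  qed
  have emp: "empirical_measure n (\<lambda>i. X i \<omega>) = empirical_measure n (Y \<omega>)" for \<omega>
    by (rule empirical_measure_cong) (simp add: Y_def)
  define c' where "c' = c powr (1 / r)"
  define K where "K \<gamma> = {x :: nat \<Rightarrow> 'a. wasserstein r (empirical_measure n (\<lambda>i. x i \<bullet> \<gamma>)) (sliced \<gamma> P) \<le> ennreal c'}" for \<gamma>
  have "closed (K \<gamma>)" for \<gamma>
  proof -
    have "closed {y. wasserstein r (empirical_measure n y) (sliced \<gamma> P) \<le> ennreal c'}"
      by (rule closed_wasserstein_empirical_le[OF n r]) (simp add: c'_def)
    moreover have "continuous_on UNIV (\<lambda>(x :: nat \<Rightarrow> 'a) i. x i \<bullet> \<gamma>)"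
      by (intro continuous_on_coordinatewise_then_product continuous_intros continuous_on_product_coordinates)
    ultimately have "closed ((\<lambda>(x :: nat \<Rightarrow> 'a) i. x i \<bullet> \<gamma>) -`
        {y. wasserstein r (empirical_measure n y) (sliced \<gamma> P) \<le> ennreal c'})"
      by (rule closed_vimage)
    then show ?thesis by (simp only: K_def vimage_def mem_Collect_eq)
  qed
  then have "closed (\<Inter>\<gamma>\<in>{\<gamma>. N \<gamma> = 1}. K \<gamma>)" by blast
  then have "Y -` (\<Inter>\<gamma>\<in>{\<gamma>. N \<gamma> = 1}. K \<gamma>) \<inter> space M \<in> sets M"
    using \<open>Y \<in> M \<rightarrow>\<^sub>M borel\<close> by (intro measurable_sets) auto
  also have "Y -` (\<Inter>\<gamma>\<in>{\<gamma>. N \<gamma> = 1}. K \<gamma>) \<inter> space M =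
      {\<omega>\<in>space M. epowr (max_sliced_wasserstein r N (empirical_measure n (\<lambda>i. X i \<omega>)) P) r \<le> ennreal c}"
    using r c by (auto simp: max_sliced_wasserstein_def SUP_le_iff emp K_def c'_def sliced_empirical_measure epowr_le_ennreal_iff)
  finally show ?thesis .
qed


section \<open>Transport on the line\<close>

text \<open>Distance as the measure of the set of separating levels, the form that exchanges with an integral over pairs.\<close>

lemma nn_integral_swept_interval:
  fixes p q :: real
  shows "(\<integral>\<^sup>+ t. indicator {t. (p \<le> t) \<noteq> (q \<le> t)} t \<partial>lborel) = ennreal \<bar>p - q\<bar>"
proof -
  have "{t. (p \<le> t) \<noteq> (q \<le> t)} = {min p q..<max p q}" by auto
  then show ?thesis by (simp add: max_def min_def abs_if)
qed

text \<open>The comonotone coupling: both quantile functions evaluated at the same uniform variable. Its mean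
  displacement is the area between the two graphs, whether swept horizontally (quantiles) or vertically (distribution functions).\<close>

lemma quantile_coupling:
  fixes \<mu> \<nu> :: "real measure"
  assumes "real_distribution \<mu>" "real_distribution \<nu>"
  obtains \<pi> where "\<pi> \<in> couplings \<mu> \<nu>"
    "(\<integral>\<^sup>+ (u, v). ennreal \<bar>u - v\<bar> \<partial>\<pi>) \<le> (\<integral>\<^sup>+ t. ennreal \<bar>cdf \<mu> t - cdf \<nu> t\<bar> \<partial>lborel)"
proof -
  interpret mu: cdf_distribution \<mu> unfolding cdf_distribution_def by fact
  interpret nu: cdf_distribution \<nu> unfolding cdf_distribution_def by fact
  let ?\<Omega> = "restrict_space lborel {0<..<1} :: real measure"
  interpret Om: prob_space ?\<Omega>
    by (auto simp: space_restrict_space emeasure_restrict_space intro!: prob_spaceI)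
  have [measurable]: "mu.I \<in> borel_measurable ?\<Omega>" "nu.I \<in> borel_measurable ?\<Omega>"
    using mu.measurable_CI nu.measurable_CI
    by (simp_all cong: measurable_cong_sets add: sets_restrict_space_cong[OF sets_lborel])
  define \<pi> where "\<pi> = distr ?\<Omega> borel (\<lambda>\<omega>. (mu.I \<omega>, nu.I \<omega>))"
  have [measurable]: "(\<lambda>\<omega>. (mu.I \<omega>, nu.I \<omega>)) \<in> ?\<Omega> \<rightarrow>\<^sub>M borel"
    unfolding borel_prod[symmetric] by measurable
  have fs: "fst \<in> (borel :: (real \<times> real) measure) \<rightarrow>\<^sub>M (borel :: real measure)"
    "snd \<in> (borel :: (real \<times> real) measure) \<rightarrow>\<^sub>M (borel :: real measure)"
    unfolding borel_prod[symmetric] by measurable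
  show ?thesis
  proof
    have "distr \<pi> borel fst = \<mu>" "distr \<pi> borel snd = \<nu>"
      unfolding \<pi>_def using fs mu.distr_I_eq_M nu.distr_I_eq_M
      by (subst distr_distr; simp add: o_def)+
    then show "\<pi> \<in> couplings \<mu> \<nu>"
      using Om.prob_space_distr[of "\<lambda>\<omega>. (mu.I \<omega>, nu.I \<omega>)" borel]
      by (simp add: couplings_def \<pi>_def)
    \<comment> \<open>\<open>H \<omega> t\<close> says that \<open>t\<close> separates the two \<open>\<omega>\<close>-quantiles, equivalently that \<open>\<omega>\<close> separates
      the two values of the distribution functions at \<open>t\<close>; both readings are measured by Fubini.\<close>
    define H :: "real \<Rightarrow> real \<Rightarrow> ennreal"
      where "H \<omega> t = (if (\<omega> \<le> cdf \<mu> t) \<noteq> (\<omega> \<le> cdf \<nu> t) then 1 else 0)" for \<omega> t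
    have [measurable]: "(\<lambda>(\<omega>, t). H \<omega> t) \<in> borel_measurable (lborel \<Otimes>\<^sub>M lborel)"
      unfolding H_def by measurable
    have "(\<integral>\<^sup>+ (u, v). ennreal \<bar>u - v\<bar> \<partial>\<pi>) = (\<integral>\<^sup>+ \<omega>. ennreal \<bar>mu.I \<omega> - nu.I \<omega>\<bar> \<partial>?\<Omega>)"
      unfolding \<pi>_def by (subst nn_integral_distr) (simp_all flip: borel_prod)
    also have "\<dots> = (\<integral>\<^sup>+ \<omega>. ennreal \<bar>mu.I \<omega> - nu.I \<omega>\<bar> * indicator {0<..<1} \<omega> \<partial>lborel)"
      by (rule nn_integral_restrict_space) simp
    also have "\<dots> = (\<integral>\<^sup>+ \<omega>. (\<integral>\<^sup>+ t. H \<omega> t * indicator {0<..<1} \<omega> \<partial>lborel) \<partial>lborel)"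
    proof (rule nn_integral_cong)
      fix \<omega> :: real
      show "ennreal \<bar>mu.I \<omega> - nu.I \<omega>\<bar> * indicator {0<..<1} \<omega> = (\<integral>\<^sup>+ t. H \<omega> t * indicator {0<..<1} \<omega> \<partial>lborel)"
      proof (cases "\<omega> \<in> {0<..<1}")
        case True
        then have pos: "0 < \<omega>" "\<omega> < 1" by auto
        have psi: "(\<omega> \<le> cdf \<mu> t) = (mu.I \<omega> \<le> t)" "(\<omega> \<le> cdf \<nu> t) = (nu.I \<omega> \<le> t)" for t
          by (rule mu.pseudoinverse[OF pos], rule nu.pseudoinverse[OF pos])
        have "H \<omega> t = indicator {t. (mu.I \<omega> \<le> t) \<noteq> (nu.I \<omega> \<le> t)} t" for t
          using psi(1)[of t] psi(2)[of t] by (simp add: H_def indicator_def)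
        then have "(\<integral>\<^sup>+ t. H \<omega> t \<partial>lborel) = ennreal \<bar>mu.I \<omega> - nu.I \<omega>\<bar>"
          by (simp only: nn_integral_swept_interval)
        then show ?thesis using True by simp
      qed simp
    qed
    also have "\<dots> = (\<integral>\<^sup>+ t. (\<integral>\<^sup>+ \<omega>. H \<omega> t * indicator {0<..<1} \<omega> \<partial>lborel) \<partial>lborel)"
      by (rule lborel_pair.Fubini') simp
    also have "\<dots> \<le> (\<integral>\<^sup>+ t. ennreal \<bar>cdf \<mu> t - cdf \<nu> t\<bar> \<partial>lborel)"
    proof (rule nn_integral_mono)
      fix t :: real
      let ?m = "min (cdf \<mu> t) (cdf \<nu> t)" and ?M = "max (cdf \<mu> t) (cdf \<nu> t)"
      have "(\<integral>\<^sup>+ \<omega>. H \<omega> t * indicator {0<..<1} \<omega> \<partial>lborel) \<le> (\<integral>\<^sup>+ \<omega>. indicator {?m<..?M} \<omega> \<partial>lborel)"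
        by (rule nn_integral_mono) (auto simp: H_def indicator_def)
      also have "\<dots> = ennreal \<bar>cdf \<mu> t - cdf \<nu> t\<bar>" by (simp add: max_def min_def abs_if)
      finally show "(\<integral>\<^sup>+ \<omega>. H \<omega> t * indicator {0<..<1} \<omega> \<partial>lborel) \<le> ennreal \<bar>cdf \<mu> t - cdf \<nu> t\<bar>" .
    qed
    finally show "(\<integral>\<^sup>+ (u, v). ennreal \<bar>u - v\<bar> \<partial>\<pi>) \<le> (\<integral>\<^sup>+ t. ennreal \<bar>cdf \<mu> t - cdf \<nu> t\<bar> \<partial>lborel)" .
  qed
qed

text \<open>Integration by parts: exchange the integrals over \<open>t < x\<close>, which leaves the tail probability \<open>1 - cdf \<mu> t\<close>.\<close>

lemma integral_primitive:
  fixes \<mu> :: "real measure" and s :: "real \<Rightarrow> real"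
  assumes "real_distribution \<mu>" and [measurable]: "s \<in> borel_measurable borel" and s: "\<And>t. \<bar>s t\<bar> \<le> 1"
    and ab: "a \<le> b"
  shows "(\<integral>x. (\<integral>t. s t * indicator {a..b} t * indicator {..<x} t \<partial>lborel) \<partial>\<mu>)
       = (\<integral>t. s t * indicator {a..b} t * (1 - cdf \<mu> t) \<partial>lborel)"
proof -
  interpret mu: real_distribution \<mu> by fact
  interpret pair_sigma_finite \<mu> lborel ..
  have meas [measurable]: "(\<lambda>(x, t). s t * indicator {a..b} t * indicator {..<x} t) \<in> borel_measurable (\<mu> \<Otimes>\<^sub>M lborel)"
  proof -
    have "(\<lambda>(x, t). s t * indicator {a..b} t * indicator {..<x} t) =
       (\<lambda>(x, t). s t * indicator {a..b} t * (if t < x then 1 else 0))"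
      by (auto simp: fun_eq_iff indicator_def)
    then show ?thesis by simp
  qed
  have "integrable (\<mu> \<Otimes>\<^sub>M lborel) (\<lambda>(x, t). s t * indicator {a..b} t * indicator {..<x} t)"
  proof (rule integrableI_bounded_set[where A = "space \<mu> \<times> {a..b}" and B = 1])
    show "emeasure (\<mu> \<Otimes>\<^sub>M lborel) (space \<mu> \<times> {a..b}) < \<infinity>"
      using ab by (subst lborel.emeasure_pair_measure_Times) (use mu.emeasure_space_1 in auto)
  qed (use s in \<open>auto simp: indicator_def abs_mult\<close>)
  then have "(\<integral>x. (\<integral>t. s t * indicator {a..b} t * indicator {..<x} t \<partial>lborel) \<partial>\<mu>)
     = (\<integral>t. (\<integral>x. s t * indicator {a..b} t * indicator {..<x} t \<partial>\<mu>) \<partial>lborel)"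
    by (rule Fubini_integral[symmetric])
  also have "\<dots> = (\<integral>t. s t * indicator {a..b} t * (1 - cdf \<mu> t) \<partial>lborel)"
  proof (rule Bochner_Integration.integral_cong[OF refl])
    fix t :: real
    have "(\<integral>x. indicator {..<x} t \<partial>\<mu>) = (\<integral>x. indicator (space \<mu> - {..t}) x \<partial>\<mu>)"
      by (rule Bochner_Integration.integral_cong) (auto simp: indicator_def)
    also have "\<dots> = 1 - cdf \<mu> t"
      by (simp add: mu.prob_compl[of "{..t}", simplified] cdf_def)
    finally show "(\<integral>x. s t * indicator {a..b} t * indicator {..<x} t \<partial>\<mu>) = s t * indicator {a..b} t * (1 - cdf \<mu> t)"
      by simp
  qed
  finally show ?thesis .
qed

lemma lipschitz_primitive:
  fixes s :: "real \<Rightarrow> real"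
  assumes [measurable]: "s \<in> borel_measurable borel" and s: "\<And>t. \<bar>s t\<bar> \<le> 1"
  shows "\<bar>(\<integral>t. s t * indicator {a..b} t * indicator {..<x} t \<partial>lborel)
        - (\<integral>t. s t * indicator {a..b} t * indicator {..<y} t \<partial>lborel)\<bar> \<le> \<bar>x - y\<bar>"
proof -
  have int: "integrable lborel (\<lambda>t. s t * indicator {a..b} t * indicator {..<x} t)" for x
    by (rule integrableI_bounded_set[where A = "{a..b}" and B = 1])
       (use s in \<open>auto simp: indicator_def abs_mult emeasure_lborel_Icc_eq\<close>)
  have "\<bar>(\<integral>t. s t * indicator {a..b} t * indicator {..<x} t \<partial>lborel)
        - (\<integral>t. s t * indicator {a..b} t * indicator {..<y} t \<partial>lborel)\<bar>
      = \<bar>\<integral>t. s t * indicator {a..b} t * indicator {..<x} t - s t * indicator {a..b} t * indicator {..<y} t \<partial>lborel\<bar>"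
    by (subst Bochner_Integration.integral_diff[OF int int]) simp
  also have "\<dots> \<le> (\<integral>t. indicator {min x y..<max x y} t \<partial>lborel)"
  proof (rule integral_abs_bound_integral)
    show "integrable lborel (\<lambda>t. s t * indicator {a..b} t * indicator {..<x} t - s t * indicator {a..b} t * indicator {..<y} t)"
      by (intro Bochner_Integration.integrable_diff int)
    show "integrable lborel (indicator {min x y..<max x y} :: real \<Rightarrow> real)"
      by (simp add: max_def min_def)
  qed (use s in \<open>auto simp: indicator_def abs_le_iff\<close>)
  also have "\<dots> = \<bar>x - y\<bar>" by (simp add: max_def min_def abs_if)
  finally show ?thesis .
qed

lemma nn_integral_cdf_diff_dual:
  fixes \<mu> \<nu> :: "real measure"
  assumes mu: "real_distribution \<mu>" and nu: "real_distribution \<nu>" and ab: "a \<le> b"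
    and "AE x in \<mu>. x \<in> {a..b}" "AE x in \<nu>. x \<in> {a..b}"
  obtains f where "\<And>x y. \<bar>f x - f y\<bar> \<le> \<bar>x - y\<bar>"
    "(\<integral>\<^sup>+ t. ennreal \<bar>cdf \<mu> t - cdf \<nu> t\<bar> \<partial>lborel) = ennreal ((\<integral>x. f x \<partial>\<mu>) - (\<integral>x. f x \<partial>\<nu>))"
    "(\<integral>x. f x \<partial>\<mu>) - (\<integral>x. f x \<partial>\<nu>) \<ge> 0"
proof -
  interpret mu: cdf_distribution \<mu> unfolding cdf_distribution_def by fact
  interpret nu: cdf_distribution \<nu> unfolding cdf_distribution_def by fact
  define s :: "real \<Rightarrow> real" where "s t = (if cdf \<mu> t \<le> cdf \<nu> t then 1 else -1)" for t
  have [measurable]: "s \<in> borel_measurable borel" unfolding s_def by measurable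
  have s: "\<bar>s t\<bar> \<le> 1" for t by (simp add: s_def)
  have cdf_out: "cdf \<rho> t = (if t < a then 0 else 1)" 
    if \<rho>: "real_distribution \<rho>" "AE x in \<rho>. x \<in> {a..b}" and t: "t \<notin> {a..b}" for \<rho> t
  proof -
    interpret rho: real_distribution \<rho> by fact
    show ?thesis
    proof (cases "t < a")
      case True
      have "AE x in \<rho>. x \<notin> {..t}" using \<rho>(2) by eventually_elim (use True in auto)
      then show ?thesis using True by (simp add: cdf_def rho.prob_eq_0)
    next
      case False
      have "AE x in \<rho>. x \<in> {..t}" using \<rho>(2) by eventually_elim (use t False in auto)
      then show ?thesis using False by (simp add: cdf_def rho.prob_eq_1)
    qed
  qed
  \<comment> \<open>The sign \<open>s\<close> is the derivative of the potential: Kantorovich--Rubinstein duality with the optimiser written down.\<close>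
  define f where "f x = (\<integral>t. s t * indicator {a..b} t * indicator {..<x} t \<partial>lborel)" for x
  have lip: "\<bar>f x - f y\<bar> \<le> \<bar>x - y\<bar>" for x y
    unfolding f_def by (rule lipschitz_primitive) (simp_all add: s)
  have int: "integrable lborel (\<lambda>t. s t * indicator {a..b} t * (1 - cdf \<rho> t))" if "real_distribution \<rho>" for \<rho>
  proof -
    interpret rho: cdf_distribution \<rho> unfolding cdf_distribution_def by fact
    show ?thesis
      by (rule integrableI_bounded_set[where A = "{a..b}" and B = 1])
       (use rho.cdf_bounded_prob rho.cdf_nonneg in \<open>auto simp: indicator_def abs_mult emeasure_lborel_Icc_eq s_def\<close>)
  qed
  have "(\<integral>x. f x \<partial>\<mu>) - (\<integral>x. f x \<partial>\<nu>) =
     (\<integral>t. s t * indicator {a..b} t * (1 - cdf \<mu> t) - s t * indicator {a..b} t * (1 - cdf \<nu> t) \<partial>lborel)"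
  proof -
    have "(\<integral>x. f x \<partial>\<mu>) = (\<integral>t. s t * indicator {a..b} t * (1 - cdf \<mu> t) \<partial>lborel)"
      unfolding f_def by (rule integral_primitive[OF mu _ s ab]) simp
    moreover have "(\<integral>x. f x \<partial>\<nu>) = (\<integral>t. s t * indicator {a..b} t * (1 - cdf \<nu> t) \<partial>lborel)"
      unfolding f_def by (rule integral_primitive[OF nu _ s ab]) simp
    ultimately show ?thesis
      using Bochner_Integration.integral_diff[OF int[OF mu] int[OF nu]] by simp
  qed
  also have "(\<lambda>t. s t * indicator {a..b} t * (1 - cdf \<mu> t) - s t * indicator {a..b} t * (1 - cdf \<nu> t))
     = (\<lambda>t. \<bar>cdf \<mu> t - cdf \<nu> t\<bar>)"
  proof
    fix t
    show "s t * indicator {a..b} t * (1 - cdf \<mu> t) - s t * indicator {a..b} t * (1 - cdf \<nu> t)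
     = \<bar>cdf \<mu> t - cdf \<nu> t\<bar>"
      using cdf_out[OF mu assms(4), of t] cdf_out[OF nu assms(5), of t]
      by (cases "t \<in> {a..b}") (auto simp: s_def algebra_simps)
  qed
  finally have eq: "(\<integral>x. f x \<partial>\<mu>) - (\<integral>x. f x \<partial>\<nu>) = (\<integral>t. \<bar>cdf \<mu> t - cdf \<nu> t\<bar> \<partial>lborel)" .
  have "integrable lborel (\<lambda>t. \<bar>cdf \<mu> t - cdf \<nu> t\<bar>)"
  proof (rule integrableI_bounded_set[where A = "{a..b}" and B = 2])
    show "AE t in lborel. t \<in> {a..b} \<longrightarrow> norm \<bar>cdf \<mu> t - cdf \<nu> t\<bar> \<le> 2"
      using mu.cdf_bounded_prob mu.cdf_nonneg nu.cdf_bounded_prob nu.cdf_nonneg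
      by (intro AE_I2 impI) (smt (verit) real_norm_def)
  qed (use cdf_out[OF mu assms(4)] cdf_out[OF nu assms(5)] in \<open>auto simp: emeasure_lborel_Icc_eq\<close>)
  then have "(\<integral>\<^sup>+ t. ennreal \<bar>cdf \<mu> t - cdf \<nu> t\<bar> \<partial>lborel) = ennreal (\<integral>t. \<bar>cdf \<mu> t - cdf \<nu> t\<bar> \<partial>lborel)"
    by (intro nn_integral_eq_integral) auto
  then show ?thesis
    using that[OF lip] eq by simp
qed

text \<open>On an interval of length \<open>b - a\<close> the cost \<open>\<bar>u - v\<bar> powr r\<close> is at most \<open>(b - a) powr (r - 1)\<close>
  times \<open>\<bar>u - v\<bar>\<close>, so the first-order dual bounds all orders. A Lipschitz test function is stable under a
  change of the direction of projection, which distribution functions are not; this is what makes the reduction useful.\<close>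

lemma wasserstein_le_lipschitz_dual:
  fixes \<mu> \<nu> :: "real measure"
  assumes mu: "real_distribution \<mu>" and nu: "real_distribution \<nu>" and ab: "a \<le> b" and r: "r \<ge> 1"
    and amu: "AE x in \<mu>. x \<in> {a..b}" and anu: "AE x in \<nu>. x \<in> {a..b}"
  obtains f where "\<And>x y. \<bar>f x - f y\<bar> \<le> \<bar>x - y\<bar>"
    "epowr (wasserstein r \<mu> \<nu>) r \<le> ennreal ((b - a) powr (r - 1) * ((\<integral>x. f x \<partial>\<mu>) - (\<integral>x. f x \<partial>\<nu>)))"
proof -
  obtain f where f: "\<And>x y. \<bar>f x - f y\<bar> \<le> \<bar>x - y\<bar>"
    "(\<integral>\<^sup>+ t. ennreal \<bar>cdf \<mu> t - cdf \<nu> t\<bar> \<partial>lborel) = ennreal ((\<integral>x. f x \<partial>\<mu>) - (\<integral>x. f x \<partial>\<nu>))"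
    "(\<integral>x. f x \<partial>\<mu>) - (\<integral>x. f x \<partial>\<nu>) \<ge> 0"
    using nn_integral_cdf_diff_dual[OF mu nu ab amu anu] by blast
  obtain \<pi> where \<pi>: "\<pi> \<in> couplings \<mu> \<nu>"
    "(\<integral>\<^sup>+ (u, v). ennreal \<bar>u - v\<bar> \<partial>\<pi>) \<le> (\<integral>\<^sup>+ t. ennreal \<bar>cdf \<mu> t - cdf \<nu> t\<bar> \<partial>lborel)"
    using quantile_coupling[OF mu nu] by blast
  have sb: "sets \<pi> = sets borel" and m1: "distr \<pi> borel fst = \<mu>" and m2: "distr \<pi> borel snd = \<nu>"
    using \<pi> by (auto simp: couplings_def)
  have [measurable_cong]: "sets \<pi> = sets ((borel :: real measure) \<Otimes>\<^sub>M (borel :: real measure))"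
    unfolding borel_prod by (rule sb)
  have "AE p in \<pi>. fst p \<in> {a..b}" using amu unfolding m1[symmetric] by (rule AE_distrD[rotated]) simp
  moreover have "AE p in \<pi>. snd p \<in> {a..b}" using anu unfolding m2[symmetric] by (rule AE_distrD[rotated]) simp
  ultimately have "AE p in \<pi>. (case p of (u, v) \<Rightarrow> ennreal (\<bar>u - v\<bar> powr r)) \<le> ennreal ((b - a) powr (r - 1)) * ennreal \<bar>fst p - snd p\<bar>"
  proof eventually_elim
    fix p :: "real \<times> real" assume p: "fst p \<in> {a..b}" "snd p \<in> {a..b}"
    obtain u v where uv: "p = (u, v)" by force
    have "\<bar>u - v\<bar> powr r \<le> (b - a) powr (r - 1) * \<bar>u - v\<bar>"
    proof (cases "u = v")
      case False
      then have "\<bar>u - v\<bar> powr r = \<bar>u - v\<bar> powr (r - 1) * \<bar>u - v\<bar>"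
        by (simp add: powr_diff)
      also have "\<dots> \<le> (b - a) powr (r - 1) * \<bar>u - v\<bar>"
        using p r uv by (intro mult_right_mono powr_mono2) auto
      finally show ?thesis .
    qed simp
    then show "(case p of (u, v) \<Rightarrow> ennreal (\<bar>u - v\<bar> powr r)) \<le> ennreal ((b - a) powr (r - 1)) * ennreal \<bar>fst p - snd p\<bar>"
      by (simp add: uv ennreal_leI flip: ennreal_mult)
  qed
  then have "(\<integral>\<^sup>+ (u, v). ennreal (\<bar>u - v\<bar> powr r) \<partial>\<pi>) \<le> (\<integral>\<^sup>+ p. ennreal ((b - a) powr (r - 1)) * ennreal \<bar>fst p - snd p\<bar> \<partial>\<pi>)"
    by (rule nn_integral_mono_AE)
  also have "\<dots> = ennreal ((b - a) powr (r - 1)) * (\<integral>\<^sup>+ (u, v). ennreal \<bar>u - v\<bar> \<partial>\<pi>)"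
    by (subst nn_integral_cmult) (simp_all add: case_prod_unfold)
  also have "\<dots> \<le> ennreal ((b - a) powr (r - 1)) * ennreal ((\<integral>x. f x \<partial>\<mu>) - (\<integral>x. f x \<partial>\<nu>))"
    using \<pi>(2) f(2) by (intro mult_left_mono) auto
  finally have le: "(\<integral>\<^sup>+ (u, v). ennreal (\<bar>u - v\<bar> powr r) \<partial>\<pi>) \<le> ennreal ((b - a) powr (r - 1) * ((\<integral>x. f x \<partial>\<mu>) - (\<integral>x. f x \<partial>\<nu>)))"
    using f(3) by (simp flip: ennreal_mult)
  have "epowr (wasserstein r \<mu> \<nu>) r = (INF \<pi>\<in>couplings \<mu> \<nu>. \<integral>\<^sup>+ (u, v). ennreal (\<bar>u - v\<bar> powr r) \<partial>\<pi>)"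
    unfolding wasserstein_def using r
    by (subst epowr_INF[symmetric], simp, subst epowr_epowr_inverse) auto
  also have "\<dots> \<le> ennreal ((b - a) powr (r - 1) * ((\<integral>x. f x \<partial>\<mu>) - (\<integral>x. f x \<partial>\<nu>)))"
    using \<pi>(1) le by (rule INF_lower2)
  finally show ?thesis using f(1) that by blast
qed

lemma sliced_wasserstein_le_lipschitz_dual:
  fixes P :: "'a::euclidean_space measure"
  assumes P: "prob_space P" "sets P = sets borel" and S: "S \<in> sets borel" "AE z in P. z \<in> S"
    and x: "\<And>i. i < n \<Longrightarrow> x i \<in> S" and n: "n > 0" and r: "r \<ge> 1"
    and D: "\<And>y z. y \<in> S \<Longrightarrow> z \<in> S \<Longrightarrow> \<bar>(y - z) \<bullet> \<gamma>\<bar> \<le> D"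
  obtains f where "\<And>s t. \<bar>f s - f t\<bar> \<le> \<bar>s - t :: real\<bar>"
    "epowr (wasserstein r (sliced \<gamma> (empirical_measure n x)) (sliced \<gamma> P)) r
      \<le> ennreal (D powr (r - 1) * ((\<Sum>i<n. f (x i \<bullet> \<gamma>)) / n - (\<integral>z. f (z \<bullet> \<gamma>) \<partial>P)))"
proof -
  have x0: "x 0 \<in> S" using x n by simp
  \<comment> \<open>The projected support lies in the interval of length \<open>D\<close> that starts at its infimum.\<close>
  define a where "a = Inf ((\<lambda>z. z \<bullet> \<gamma>) ` S)"
  have bdd: "bdd_below ((\<lambda>z. z \<bullet> \<gamma>) ` S)"
    using D[OF x0] by (intro bdd_belowI2[of _ "x 0 \<bullet> \<gamma> - D"]) (simp add: inner_diff_left abs_le_iff algebra_simps)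
  have ab: "z \<bullet> \<gamma> \<in> {a..a + D}" if z: "z \<in> S" for z
  proof -
    have "a \<le> z \<bullet> \<gamma>" unfolding a_def using bdd z by (intro cInf_lower) auto
    moreover have "z \<bullet> \<gamma> - D \<le> a" unfolding a_def
      using x0 D[OF z] by (intro cInf_greatest) (auto simp: inner_diff_left abs_le_iff algebra_simps)
    ultimately show ?thesis by simp
  qed
  have D0: "D \<ge> 0" using D[OF x0 x0] by simp
  obtain f where f: "\<And>s t. \<bar>f s - f t\<bar> \<le> \<bar>s - t\<bar>"
    "epowr (wasserstein r (sliced \<gamma> (empirical_measure n x)) (sliced \<gamma> P)) r
      \<le> ennreal ((a + D - a) powr (r - 1) * ((\<integral>t. f t \<partial>sliced \<gamma> (empirical_measure n x)) - (\<integral>t. f t \<partial>sliced \<gamma> P)))"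
  proof (rule wasserstein_le_lipschitz_dual)
    show "real_distribution (sliced \<gamma> (empirical_measure n x))"
      using n by (intro real_distribution_sliced prob_space_empirical_measure sets_empirical_measure)
    show "real_distribution (sliced \<gamma> P)" by (rule real_distribution_sliced[OF P])
    show "AE t in sliced \<gamma> (empirical_measure n x). t \<in> {a..a + D}"
      by (rule AE_sliced[OF sets_empirical_measure AE_empirical_measure[OF n x S(1)] ab])
    show "AE t in sliced \<gamma> P. t \<in> {a..a + D}" by (rule AE_sliced[OF P(2) S(2) ab])
    show "a \<le> a + D" using D0 by simp
  qed (use r in auto)
  have "1-lipschitz_on UNIV f" using f(1) by (intro lipschitz_onI) (auto simp: dist_real_def)
  then have fm: "f \<in> borel_measurable borel"
    by (intro borel_measurable_continuous_onI lipschitz_on_continuous_on)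
  have "(\<integral>t. f t \<partial>sliced \<gamma> (empirical_measure n x)) = (\<Sum>i<n. f (x i \<bullet> \<gamma>)) / n"
    using n fm by (subst integral_sliced) (auto intro!: integral_empirical_measure)
  moreover have "(\<integral>t. f t \<partial>sliced \<gamma> P) = (\<integral>z. f (z \<bullet> \<gamma>) \<partial>P)"
    by (rule integral_sliced[OF P(2) fm])
  ultimately show ?thesis using f(2) by (intro that[of f, OF f(1)]) simp
qed


section \<open>Norms and dual norms\<close>

lemma is_normD:
  assumes "is_norm N"
  shows is_norm_nonneg: "0 \<le> N x" and is_norm_eq_0_iff: "N x = 0 \<longleftrightarrow> x = 0"
    and is_norm_scaleR: "N (c *\<^sub>R x) = \<bar>c\<bar> * N x" and is_norm_triangle: "N (x + y) \<le> N x + N y"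
  using assms unfolding is_norm_def by blast+

lemma is_norm_minus: "is_norm N \<Longrightarrow> N (- x) = N x"
  using is_norm_scaleR[of N "-1" x] by simp

lemma is_norm_triangle_diff: "is_norm N \<Longrightarrow> N (x - y) \<le> N x + N y"
  using is_norm_triangle[of N x "- y"] by (simp add: is_norm_minus)

lemma is_norm_bounded_above:
  fixes N :: "'a::euclidean_space \<Rightarrow> real"
  assumes N: "is_norm N"
  obtains B where "B > 0" "\<And>x. N x \<le> B * norm x"
proof
  define B where "B = (\<Sum>b\<in>Basis. N (b::'a)) + 1"
  show "B > 0" unfolding B_def using is_norm_nonneg[OF N] by (simp add: sum_nonneg add_nonneg_pos)
  have N_sum: "N (\<Sum>b\<in>A. g b) \<le> (\<Sum>b\<in>A. N (g b))" if "finite A" for A and g :: "'a \<Rightarrow> 'a"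
    using that
  proof (induction A)
    case (insert a A)
    then show ?case using is_norm_triangle[OF N, of "g a" "sum g A"] by simp
  qed (use is_norm_eq_0_iff[OF N, of 0] in simp)
  fix x :: 'a
  have "N x = N (\<Sum>b\<in>Basis. (x \<bullet> b) *\<^sub>R b)" by (simp add: euclidean_representation)
  also have "\<dots> \<le> (\<Sum>b\<in>Basis. N ((x \<bullet> b) *\<^sub>R b))" by (rule N_sum) simp
  also have "\<dots> \<le> (\<Sum>b\<in>Basis. norm x * N b)"
    by (rule sum_mono) (simp add: is_norm_scaleR[OF N] mult_right_mono is_norm_nonneg[OF N] Basis_le_norm)
  also have "\<dots> \<le> B * norm x" by (simp add: B_def sum_distrib_left algebra_simps)
  finally show "N x \<le> B * norm x" .
qed

lemma is_norm_continuous: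
  fixes N :: "'a::euclidean_space \<Rightarrow> real"
  assumes N: "is_norm N"
  shows "continuous_on A N"
proof -
  obtain B where B: "B > 0" "\<And>x. N x \<le> B * norm x" using is_norm_bounded_above[OF N] by blast
  have "\<bar>N x - N y\<bar> \<le> B * dist x y" for x y
    using is_norm_triangle[OF N, of "x - y" y] is_norm_triangle[OF N, of "y - x" x] B(2)[of "x - y"]
      B(2)[of "y - x"] by (simp add: dist_norm norm_minus_commute)
  then have "B-lipschitz_on A N" using B(1) by (intro lipschitz_onI) (auto simp: dist_real_def)
  then show ?thesis by (rule lipschitz_on_continuous_on)
qed

text \<open>Equivalence with the Euclidean norm: the minimum over the compact Euclidean unit sphere is positive.\<close>

lemma is_norm_bounded_below:
  fixes N :: "'a::euclidean_space \<Rightarrow> real"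
  assumes N: "is_norm N"
  obtains m where "m > 0" "\<And>x. m * norm x \<le> N x"
proof -
  obtain z where z: "norm z = 1" "\<And>x. norm x = 1 \<Longrightarrow> N z \<le> N x"
  proof -
    have "sphere (0::'a) 1 \<noteq> {}" by simp
    then show ?thesis
      using continuous_attains_inf[OF compact_sphere _ is_norm_continuous[OF N], of 0 1] that by auto
  qed
  show ?thesis
  proof
    show "N z > 0" using z(1) is_norm_nonneg[OF N, of z] is_norm_eq_0_iff[OF N, of z] by force
    fix x :: 'a
    show "N z * norm x \<le> N x"
    proof (cases "x = 0")
      case False
      then have "N z \<le> N ((1 / norm x) *\<^sub>R x)" by (intro z(2)) simp
      then show ?thesis using False by (simp add: is_norm_scaleR[OF N] field_simps)
    qed (simp add: is_norm_nonneg[OF N])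
  qed
qed

lemma compact_is_norm_sphere:
  fixes N :: "'a::euclidean_space \<Rightarrow> real"
  assumes N: "is_norm N" shows "compact {y. N y = 1}"
proof -
  obtain m where m: "m > 0" "\<And>x. m * norm x \<le> N x" using is_norm_bounded_below[OF N] by blast
  have "bounded {y. N y = 1}"
    by (rule boundedI[of _ "1 / m"]) (use m in \<open>auto simp: field_simps mult.commute\<close>, metis mult.commute)
  moreover have "closed {y. N y = 1}"
    using continuous_closed_preimage_constant[OF is_norm_continuous[OF N, of UNIV] closed_UNIV] by simp
  ultimately show ?thesis by (simp add: compact_eq_bounded_closed)
qed

lemma is_norm_sphere_nonempty:
  fixes N :: "'a::euclidean_space \<Rightarrow> real"
  assumes N: "is_norm N" shows "{y. N y = 1} \<noteq> {}"
proof -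
  obtain b :: 'a where "b \<in> Basis" by (meson ex_in_conv nonempty_Basis)
  then have "N b \<noteq> 0" using is_norm_eq_0_iff[OF N] nonzero_Basis by blast
  then have "N ((1 / N b) *\<^sub>R b) = 1" using is_norm_nonneg[OF N, of b] by (simp add: is_norm_scaleR[OF N])
  then show ?thesis by blast
qed

text \<open>The supremum in the definition of the dual norm is over a compact set, hence finite, and bounds \<open>x \<bullet> y\<close>
  after normalising \<open>y\<close>.\<close>

lemma inner_le_dual_norm:
  fixes N :: "'a::euclidean_space \<Rightarrow> real"
  assumes N: "is_norm N" shows "x \<bullet> y \<le> dual_norm N x * N y"
proof (cases "y = 0")
  case True
  then show ?thesis using is_norm_eq_0_iff[OF N, of 0] by simp
next
  case False
  then have pos: "N y > 0" using is_norm_nonneg[OF N, of y] is_norm_eq_0_iff[OF N, of y] by force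
  have "bdd_above ((\<lambda>y. x \<bullet> y) ` {y. N y = 1})"
    by (intro bounded_imp_bdd_above compact_imp_bounded compact_continuous_image compact_is_norm_sphere[OF N] continuous_intros)
  moreover have "N ((1 / N y) *\<^sub>R y) = 1" using pos by (simp add: is_norm_scaleR[OF N])
  ultimately have "x \<bullet> ((1 / N y) *\<^sub>R y) \<le> dual_norm N x"
    unfolding dual_norm_def by (intro cSUP_upper) auto
  then show ?thesis using pos by (simp add: field_simps)
qed

lemma dual_norm_bounded:
  fixes N :: "'a::euclidean_space \<Rightarrow> real"
  assumes N: "is_norm N"
  obtains B where "\<And>x. dual_norm N x \<le> B * norm x"
proof -
  obtain m where m: "m > 0" "\<And>x. m * norm x \<le> N x" using is_norm_bounded_below[OF N] by blast
  have "dual_norm N x \<le> (1 / m) * norm x" for x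
    unfolding dual_norm_def
  proof (rule cSUP_least[OF is_norm_sphere_nonempty[OF N]])
    fix y assume "y \<in> {y. N y = 1}"
    then have "norm y \<le> 1 / m" using m(2)[of y] m(1) by (simp add: field_simps)
    then have "norm x * norm y \<le> norm x * (1 / m)" by (rule mult_left_mono) simp
    then show "x \<bullet> y \<le> (1 / m) * norm x" using norm_cauchy_schwarz[of x y] by (simp add: mult.commute)
  qed
  then show ?thesis using that by blast
qed

text \<open>The dual diameter bounds the width of the set in every direction. Boundedness makes the supremum
  defining the diameter an upper bound.\<close>

lemma inner_diff_le_norm_diam:
  fixes N :: "'a::euclidean_space \<Rightarrow> real"
  assumes N: "is_norm N" and S: "bounded S" and xy: "x \<in> S" "y \<in> S"
  shows "\<bar>(x - y) \<bullet> g\<bar> \<le> norm_diam (dual_norm N) S * N g"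
proof -
  obtain B where B: "\<And>x. dual_norm N x \<le> B * norm x" using dual_norm_bounded[OF N] by blast
  define D where "D = diameter S"
  have D: "dist x y \<le> D" if "x \<in> S" "y \<in> S" for x y
    unfolding D_def by (rule diameter_bounded_bound[OF S that])
  have "bdd_above ((\<lambda>(x, y). dual_norm N (x - y)) ` (S \<times> S))"
  proof (rule bdd_aboveI2)
    fix p assume "p \<in> S \<times> S"
    then have "norm (fst p - snd p) \<le> D" using D[of "fst p" "snd p"] by (auto simp: dist_norm)
    then have "\<bar>B\<bar> * norm (fst p - snd p) \<le> \<bar>B\<bar> * D" by (intro mult_left_mono) auto
    moreover have "B * norm (fst p - snd p) \<le> \<bar>B\<bar> * norm (fst p - snd p)" by (intro mult_right_mono) auto
    ultimately show "(case p of (x, y) \<Rightarrow> dual_norm N (x - y)) \<le> \<bar>B\<bar> * D"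
      using B[of "fst p - snd p"] by (simp add: case_prod_unfold)
  qed
  then have le: "dual_norm N (u - v) \<le> norm_diam (dual_norm N) S" if "u \<in> S" "v \<in> S" for u v
    unfolding norm_diam_def using that cSUP_upper[of "(u, v)" "S \<times> S" "\<lambda>(x, y). dual_norm N (x - y)"] by auto
  have "(u - v) \<bullet> g \<le> norm_diam (dual_norm N) S * N g" if "u \<in> S" "v \<in> S" for u v
    using inner_le_dual_norm[OF N, of "u - v" g] mult_right_mono[OF le[OF that] is_norm_nonneg[OF N, of g]] by linarith
  from this[OF xy] this[OF xy(2,1)] show ?thesis by (simp add: abs_le_iff inner_diff_left)
qed


section \<open>Metric entropy\<close>

lemma is_norm_ball_volume:
  fixes N :: "'a::euclidean_space \<Rightarrow> real"
  assumes N: "is_norm N" and \<rho>: "\<rho> > 0"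
  shows "{x. N (x - z) < \<rho>} \<in> lmeasurable"
    and "measure lebesgue {x. N (x - z) < \<rho>} = \<rho> ^ DIM('a) * measure lebesgue {x. N x < 1}"
    and "measure lebesgue {x. N x < 1} > 0"
proof -
  obtain m where m: "m > 0" "\<And>x. m * norm x \<le> N x" using is_norm_bounded_below[OF N] by blast
  have op: "open {x. N (x - z) < \<rho>}" for z \<rho>
    by (intro open_Collect_less continuous_on_compose2[OF is_norm_continuous[OF N, of UNIV]] continuous_intros) auto
  have bd: "bounded {x. N (x - z) < \<rho>}" for z \<rho>
  proof (rule boundedI)
    fix x assume "x \<in> {x. N (x - z) < \<rho>}"
    then have "norm (x - z) \<le> \<rho> / m" using m(1) m(2)[of "x - z"] by (simp add: field_simps)
    then show "norm x \<le> norm z + \<rho> / m" using norm_triangle_sub[of x z] by simp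
  qed
  show meas: "{x. N (x - z) < \<rho>} \<in> lmeasurable" by (intro lmeasurable_open bd op)
  have eq: "{x. N (x - z) < \<rho>} = (\<lambda>x. \<rho> *\<^sub>R x + z) ` {x. N x < 1}"
  proof (intro equalityI subsetI)
    fix x assume "x \<in> {x. N (x - z) < \<rho>}"
    then have "N ((1 / \<rho>) *\<^sub>R (x - z)) < 1" using \<rho> by (simp add: is_norm_scaleR[OF N])
    then show "x \<in> (\<lambda>x. \<rho> *\<^sub>R x + z) ` {x. N x < 1}"
      using \<rho> by (intro image_eqI[of _ _ "(1 / \<rho>) *\<^sub>R (x - z)"]) auto
  qed (use \<rho> in \<open>auto simp: is_norm_scaleR[OF N]\<close>)
  show "measure lebesgue {x. N (x - z) < \<rho>} = \<rho> ^ DIM('a) * measure lebesgue {x. N x < 1}"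
    unfolding eq using measure_lebesgue_affine[of \<rho> z "{x. N x < 1}"] \<rho> by simp
  have "N 0 = 0" using is_norm_eq_0_iff[OF N] by blast
  then have "0 \<in> {x. N x < 1}" by simp
  then show "measure lebesgue {x. N x < 1} > 0"
    using op[of 0 1] bd[of 0 1] open_not_negligible[of "{x. N x < 1}"]
    by (auto simp: negligible_iff_measure zero_less_measure_iff lmeasurable_open)
qed

text \<open>Volume comparison: the balls of radius \<open>\<delta> / 2\<close> around a \<open>\<delta>\<close>-separated set are disjoint and lie in the
  ball of radius \<open>1 + \<delta> / 2\<close>. Balls of the norm itself are compared, so the count does not depend on its shape.\<close>

lemma is_norm_sphere_net:
  fixes N :: "'a::euclidean_space \<Rightarrow> real"
  assumes N: "is_norm N" and \<delta>: "\<delta> > 0"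
  obtains \<Gamma> where "\<Gamma> \<subseteq> {g. N g = 1}" "finite \<Gamma>" "real (card \<Gamma>) \<le> (1 + 2 / \<delta>) ^ DIM('a)"
    "\<And>g. N g = 1 \<Longrightarrow> \<exists>h\<in>\<Gamma>. N (g - h) \<le> \<delta>"
proof -
  define sep where "sep \<Gamma> \<longleftrightarrow> \<Gamma> \<subseteq> {g. N g = 1} \<and> finite \<Gamma> \<and> (\<forall>g\<in>\<Gamma>. \<forall>h\<in>\<Gamma>. g \<noteq> h \<longrightarrow> N (g - h) > \<delta>)" for \<Gamma>
  have card_le: "real (card \<Gamma>) \<le> (1 + 2 / \<delta>) ^ DIM('a)" if "sep \<Gamma>" for \<Gamma>
  proof -
    let ?V = "measure lebesgue {x. N x < 1}"
    let ?b = "\<lambda>g. {x. N (x - g) < \<delta> / 2}"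
    have b_meas: "?b g \<in> lmeasurable" for g using \<delta> by (intro is_norm_ball_volume(1)[OF N]) simp
    have \<Gamma>: "\<Gamma> \<subseteq> {g. N g = 1}" "finite \<Gamma>" "\<And>g h. g \<in> \<Gamma> \<Longrightarrow> h \<in> \<Gamma> \<Longrightarrow> g \<noteq> h \<Longrightarrow> N (g - h) > \<delta>"
      using that by (auto simp: sep_def)
    have disj: "disjoint_family_on ?b \<Gamma>"
      unfolding disjoint_family_on_def
    proof (intro ballI impI)
      fix g h assume gh: "g \<in> \<Gamma>" "h \<in> \<Gamma>" "g \<noteq> h"
      show "?b g \<inter> ?b h = {}"
      proof (rule ccontr)
        assume "?b g \<inter> ?b h \<noteq> {}"
        then obtain x where "N (x - g) < \<delta> / 2" "N (x - h) < \<delta> / 2" by auto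
        then have "N (g - h) < \<delta>"
          using is_norm_triangle_diff[OF N, of "x - h" "x - g"] by simp
        then show False using \<Gamma>(3)[OF gh] by simp
      qed
    qed
    have sub: "(\<Union>g\<in>\<Gamma>. ?b g) \<subseteq> {x. N (x - 0) < 1 + \<delta> / 2}"
    proof safe
      fix g x assume "g \<in> \<Gamma>" "N (x - g) < \<delta> / 2"
      then show "N (x - 0) < 1 + \<delta> / 2"
        using is_norm_triangle[OF N, of "x - g" g] \<Gamma>(1) by auto
    qed
    have "real (card \<Gamma>) * ((\<delta> / 2) ^ DIM('a) * ?V) = (\<Sum>g\<in>\<Gamma>. measure lebesgue (?b g))"
      by (subst is_norm_ball_volume(2)[OF N]) (use \<delta> in simp_all)
    also have "\<dots> = measure lebesgue (\<Union>g\<in>\<Gamma>. ?b g)"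
      using \<Gamma>(2) b_meas disj
      by (intro measure_UNION'[symmetric]) (simp_all add: disjoint_family_on_def pairwise_def disjnt_def)
    also have "\<dots> \<le> measure lebesgue {x. N (x - 0) < 1 + \<delta> / 2}"
    proof (intro measure_mono_fmeasurable sub)
      show "(\<Union>g\<in>\<Gamma>. ?b g) \<in> sets lebesgue"
        using \<Gamma>(2) b_meas by (intro sets.finite_UN fmeasurableD)
      show "{x. N (x - 0) < 1 + \<delta> / 2} \<in> lmeasurable"
        using \<delta> by (intro is_norm_ball_volume(1)[OF N]) simp
    qed
    also have "\<dots> = (1 + \<delta> / 2) ^ DIM('a) * ?V"
      using \<delta> by (intro is_norm_ball_volume(2)[OF N]) auto
    finally have "real (card \<Gamma>) * (\<delta> / 2) ^ DIM('a) \<le> (1 + \<delta> / 2) ^ DIM('a)"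
      using is_norm_ball_volume(3)[OF N zero_less_one] by (simp add: mult.assoc[symmetric])
    then have "real (card \<Gamma>) \<le> ((1 + \<delta> / 2) / (\<delta> / 2)) ^ DIM('a)"
      unfolding power_divide using \<delta> by (subst pos_le_divide_eq) simp_all
    also have "(1 + \<delta> / 2) / (\<delta> / 2) = 1 + 2 / \<delta>" using \<delta> by (simp add: field_simps)
    finally show ?thesis .
  qed
  \<comment> \<open>A separated set of the largest possible size cannot be extended, so it is a net.\<close>
  have "sep {}" by (simp add: sep_def)
  then have "\<exists>\<Gamma>. sep \<Gamma> \<and> card \<Gamma> = 0" by (metis card.empty)
  moreover have "k \<le> nat \<lceil>(1 + 2 / \<delta>) ^ DIM('a)\<rceil>" if "\<exists>\<Gamma>. sep \<Gamma> \<and> card \<Gamma> = k" for k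
    using that card_le by (metis nat_mono ceiling_mono ceiling_of_nat nat_int)
  ultimately obtain \<Gamma> where \<Gamma>: "sep \<Gamma>" and max: "\<And>\<Gamma>'. sep \<Gamma>' \<Longrightarrow> card \<Gamma>' \<le> card \<Gamma>"
    using GreatestI_nat[of "\<lambda>k. \<exists>\<Gamma>. sep \<Gamma> \<and> card \<Gamma> = k" 0] Greatest_le_nat[of "\<lambda>k. \<exists>\<Gamma>. sep \<Gamma> \<and> card \<Gamma> = k"]
    by (metis (no_types, lifting))
  have "\<exists>h\<in>\<Gamma>. N (g - h) \<le> \<delta>" if g: "N g = 1" for g
  proof (rule ccontr)
    assume far: "\<not> (\<exists>h\<in>\<Gamma>. N (g - h) \<le> \<delta>)"
    have "N (g - g) = 0" using is_norm_eq_0_iff[OF N] by simp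
    then have "g \<notin> \<Gamma>" using far \<delta> by (metis less_imp_le)
    have "N (h - g) = N (g - h)" for h using is_norm_minus[OF N, of "g - h"] by simp
    then have "sep (insert g \<Gamma>)" using \<Gamma> far g by (auto simp: sep_def not_le)
    from max[OF this] show False using \<open>g \<notin> \<Gamma>\<close> \<Gamma> by (simp add: sep_def)
  qed
  then show ?thesis using that[of \<Gamma>] \<Gamma> card_le by (auto simp: sep_def)
qed

text \<open>The value at \<open>0\<close> is fixed because deviations do not see additive constants, and without it no finite net could exist.\<close>

definition lipschitz_pinned :: "(real \<Rightarrow> real) set" where
  "lipschitz_pinned = {f. (\<forall>x y. \<bar>f x - f y\<bar> \<le> \<bar>x - y\<bar>) \<and> f 0 = 0}"

lemma lipschitz_pinned_continuous:
  assumes "f \<in> lipschitz_pinned" shows "continuous_on A f"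
proof -
  have "1-lipschitz_on A f"
    using assms by (intro lipschitz_onI) (auto simp: lipschitz_pinned_def dist_real_def)
  then show ?thesis by (rule lipschitz_on_continuous_on)
qed

text \<open>Round the values on a grid of mesh \<open>h = 2 / m\<close> down to multiples of \<open>h\<close>. A Lipschitz function moves by
  at most one level per step, so its rounded graph is a walk from \<open>0\<close> with \<open>m\<close> steps in \<open>{-1, 0, 1}\<close>, and functions with the
  same walk are uniformly close.\<close>

lemma lipschitz_pinned_net:
  assumes m: "m > 0"
  obtains T where "T \<subseteq> lipschitz_pinned" "finite T" "card T \<le> 3 ^ m"
    "\<And>f. f \<in> lipschitz_pinned \<Longrightarrow> \<exists>g\<in>T. \<forall>t\<in>{0..2}. \<bar>f t - g t\<bar> \<le> 6 / real m"
proof -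
  define h where "h = 2 / real m"
  have h: "h > 0" "real m * h = 2" using m by (auto simp: h_def)
  define lev where "lev f j = \<lfloor>f (real j * h) / h\<rfloor>" for f :: "real \<Rightarrow> real" and j
  define code where "code f = map (\<lambda>j. lev f (Suc j) - lev f j) [0..<m]" for f
  define W where "W = {xs :: int list. set xs \<subseteq> {-1, 0, 1} \<and> length xs = m}"
  have W: "finite W" "card W = 3 ^ m"
    unfolding W_def by (simp_all add: finite_lists_length_eq card_lists_length_eq numeral_3_eq_3)
  have code_W: "code f \<in> W" if f: "f \<in> lipschitz_pinned" for f
  proof -
    have "lev f (Suc j) - lev f j \<in> {-1, 0, 1}" for j
    proof -
      have "\<bar>f (real (Suc j) * h) - f (real j * h)\<bar> \<le> \<bar>real (Suc j) * h - real j * h\<bar>"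
        using f by (auto simp: lipschitz_pinned_def)
      also have "\<dots> = h" using h by (simp add: algebra_simps)
      finally have "\<bar>f (real (Suc j) * h) / h - f (real j * h) / h\<bar> \<le> 1"
        using h by (simp add: diff_divide_distrib[symmetric] abs_divide del: of_nat_Suc)
      then have "\<bar>lev f (Suc j) - lev f j\<bar> \<le> 1" unfolding lev_def by linarith
      then show ?thesis by auto
    qed
    then have "set (code f) \<subseteq> {-1, 0, 1}" unfolding code_def set_map by blast
    then show ?thesis by (simp add: code_def W_def)
  qed
  have lev_eq: "lev f j = lev g j"
    if f: "f \<in> lipschitz_pinned" and g: "g \<in> lipschitz_pinned" and eq: "code f = code g" and j: "j \<le> m" for f g j
    using j
  proof (induction j)
    case 0
    then show ?case using f g by (simp add: lev_def lipschitz_pinned_def)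
  next
    case (Suc j)
    then have "code f ! j = code g ! j" "j < m" using eq by auto
    then show ?case using Suc by (simp add: code_def)
  qed
  \<comment> \<open>One function per realised code, so that the net consists of Lipschitz functions itself.\<close>
  define rep where "rep c = (SOME f. f \<in> lipschitz_pinned \<and> code f = c)" for c
  have rep: "rep (code f) \<in> lipschitz_pinned" "code (rep (code f)) = code f" if "f \<in> lipschitz_pinned" for f
    using someI[of "\<lambda>g. g \<in> lipschitz_pinned \<and> code g = code f" f] that by (auto simp: rep_def)
  show ?thesis
  proof
    let ?T = "rep ` code ` lipschitz_pinned"
    have sub: "code ` lipschitz_pinned \<subseteq> W" using code_W by auto
    then have fin: "finite (code ` lipschitz_pinned)" using W finite_subset by blast
    show "?T \<subseteq> lipschitz_pinned" using rep by auto
    show "finite ?T" using fin by simp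
    show "card ?T \<le> 3 ^ m"
      using card_image_le[OF fin, of rep] card_mono[OF W(1) sub] W(2) by simp
    fix f assume f: "f \<in> lipschitz_pinned"
    define g where "g = rep (code f)"
    have g: "g \<in> lipschitz_pinned" "code f = code g" using rep[OF f] unfolding g_def by simp_all
    have "\<bar>f t - g t\<bar> \<le> 6 / real m" if t: "t \<in> {0..2}" for t
    proof -
      define j where "j = nat \<lfloor>t / h\<rfloor>"
      have j0: "real j \<le> t / h" "t / h < real j + 1"
      proof -
        have "real j = of_int \<lfloor>t / h\<rfloor>" using t h by (simp add: j_def)
        then show "real j \<le> t / h" "t / h < real j + 1" by linarith+
      qed
      then have tj: "\<bar>t - real j * h\<bar> \<le> h" using h by (auto simp: field_simps abs_le_iff)
      have "t / h \<le> m" using t h by (simp add: field_simps)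
      then have "j \<le> m" using j0 by linarith
      then have "lev f j = lev g j" using lev_eq[OF f g] by simp
      then have "\<bar>f (real j * h) / h - g (real j * h) / h\<bar> \<le> 1" unfolding lev_def by linarith
      then have "\<bar>f (real j * h) - g (real j * h)\<bar> \<le> h"
        using h by (simp add: diff_divide_distrib[symmetric] abs_divide)
      moreover have "\<bar>f t - f (real j * h)\<bar> \<le> \<bar>t - real j * h\<bar>" "\<bar>g t - g (real j * h)\<bar> \<le> \<bar>t - real j * h\<bar>"
        using f g by (auto simp: lipschitz_pinned_def)
      \<comment> \<open>At most \<open>h\<close> from \<open>t\<close> to the grid point, \<open>h\<close> between the functions there, and \<open>h\<close> back.\<close>
      ultimately have "\<bar>f t - g t\<bar> \<le> 3 * h" using tj by linarith
      then show ?thesis by (simp add: h_def)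
    qed
    then show "\<exists>g\<in>?T. \<forall>t\<in>{0..2}. \<bar>f t - g t\<bar> \<le> 6 / real m"
      using f by (intro bexI[of _ g]) (auto simp: g_def)
  qed
qed

text \<open>Lipschitz functions of a one-dimensional projection. The affine normalisation sends the points within
  distance \<open>D\<close> of \<open>x0\<close> in direction \<open>g\<close> into the interval from \<open>0\<close> to \<open>2\<close>.\<close>

definition lipschitz_ridge :: "('a::euclidean_space \<Rightarrow> real) \<Rightarrow> 'a \<Rightarrow> real \<Rightarrow> ('a \<Rightarrow> real) set" where
  "lipschitz_ridge N x0 D = {\<lambda>x. f ((x - x0) \<bullet> g / D + 1) | f g. f \<in> lipschitz_pinned \<and> N g = 1}"

lemma lipschitz_ridge_measurable:
  assumes D: "D > 0" and \<phi>F: "\<phi> \<in> lipschitz_ridge N x0 D"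
  shows "\<phi> \<in> borel_measurable borel"
proof -
  obtain f g where f: "f \<in> lipschitz_pinned" and \<phi>: "\<phi> = (\<lambda>x. f ((x - x0) \<bullet> g / D + 1))"
    using \<phi>F by (auto simp: lipschitz_ridge_def)
  have "continuous_on UNIV \<phi>" unfolding \<phi> using D
    by (intro continuous_on_compose2[OF lipschitz_pinned_continuous[OF f, of UNIV]] continuous_intros) auto
  then show ?thesis by (rule borel_measurable_continuous_onI)
qed

lemma lipschitz_ridge_range:
  assumes D: "D > 0"
    and diam: "\<And>x y g. x \<in> S \<Longrightarrow> y \<in> S \<Longrightarrow> \<bar>(x - y) \<bullet> g\<bar> \<le> D * N g"
    and \<phi>F: "\<phi> \<in> lipschitz_ridge N x0 D" and xy: "x \<in> S" "y \<in> S"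
  shows "\<bar>\<phi> x - \<phi> y\<bar> \<le> 1"
proof -
  obtain f g where f: "f \<in> lipschitz_pinned" and g: "N g = 1" and \<phi>: "\<phi> = (\<lambda>x. f ((x - x0) \<bullet> g / D + 1))"
    using \<phi>F by (auto simp: lipschitz_ridge_def)
  have "\<bar>\<phi> x - \<phi> y\<bar> \<le> \<bar>((x - x0) \<bullet> g / D + 1) - ((y - x0) \<bullet> g / D + 1)\<bar>"
    using f unfolding \<phi> lipschitz_pinned_def by blast
  also have "((x - x0) \<bullet> g / D + 1) - ((y - x0) \<bullet> g / D + 1) = (x - y) \<bullet> g / D"
    by (simp add: inner_diff_left diff_divide_distrib)
  also have "\<bar>(x - y) \<bullet> g / D\<bar> \<le> 1" using diam[OF xy, of g] D g by (simp add: abs_divide)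
  finally show ?thesis .
qed

text \<open>Up to an affine change of the value, every slice of a Lipschitz function is a ridge function; \<open>b\<close>
  cancels in deviations and \<open>D\<close> supplies the last power of the diameter.\<close>

lemma lipschitz_slice_as_ridge:
  fixes f :: "real \<Rightarrow> real"
  assumes f: "\<And>s t. \<bar>f s - f t\<bar> \<le> \<bar>s - t\<bar>" and g: "N g = 1" and D: "D > 0"
  obtains \<phi> b where "\<phi> \<in> lipschitz_ridge N x0 D" "\<And>z. f (z \<bullet> g) = D * \<phi> z + b"
proof
  \<comment> \<open>For \<open>z\<close> within distance \<open>D\<close> of \<open>x0\<close> along \<open>g\<close>, the normalised projection lies in the interval from \<open>0\<close> to \<open>2\<close>;
    \<open>h\<close> is \<open>f\<close> in this coordinate, pinned at its left end.\<close>
  define h where "h s = (f (D * (s - 1) + x0 \<bullet> g) - f (x0 \<bullet> g - D)) / D" for s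
  have "\<bar>h s - h t\<bar> \<le> \<bar>s - t\<bar>" for s t
  proof -
    have "h s - h t = (f (D * (s - 1) + x0 \<bullet> g) - f (D * (t - 1) + x0 \<bullet> g)) / D"
      by (simp add: h_def diff_divide_distrib)
    moreover have "\<bar>f (D * (s - 1) + x0 \<bullet> g) - f (D * (t - 1) + x0 \<bullet> g)\<bar> \<le> \<bar>D * (s - t)\<bar>"
      using f[of "D * (s - 1) + x0 \<bullet> g" "D * (t - 1) + x0 \<bullet> g"] by (simp add: algebra_simps)
    moreover have "\<bar>D * (s - t)\<bar> = D * \<bar>s - t\<bar>" using D by (simp add: abs_mult)
    ultimately show ?thesis using D by (simp add: pos_divide_le_eq mult.commute)
  qed
  then have "h \<in> lipschitz_pinned" by (simp add: lipschitz_pinned_def h_def)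
  then show "(\<lambda>z. h ((z - x0) \<bullet> g / D + 1)) \<in> lipschitz_ridge N x0 D"
    using g unfolding lipschitz_ridge_def by blast
  show "f (z \<bullet> g) = D * h ((z - x0) \<bullet> g / D + 1) + f (x0 \<bullet> g - D)" for z
    using D by (simp add: h_def inner_diff_left)
qed

text \<open>Since \<open>f\<close> is Lipschitz, changing the direction by \<open>\<delta>\<close> in norm changes the ridge function by at most \<open>\<delta>\<close>
  on the support; so nets for directions and for profiles combine. The entropy of the profiles grows like the inverse precision
  \<open>4 ^ k\<close>, the one of the directions only like \<open>k\<close> times the dimension, and both fit under one bound.\<close>

lemma lipschitz_ridge_net:
  fixes N :: "'a::euclidean_space \<Rightarrow> real"
  assumes N: "is_norm N" and D: "D > 0"
    and diam: "\<And>x y g. x \<in> S \<Longrightarrow> y \<in> S \<Longrightarrow> \<bar>(x - y) \<bullet> g\<bar> \<le> D * N g" and x0: "x0 \<in> S"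
  obtains T where "T \<subseteq> lipschitz_ridge N x0 D" "finite T"
    "real (card T) \<le> exp (64 * (real DIM('a) + 1) * 4 ^ k)"
    "\<And>\<phi>. \<phi> \<in> lipschitz_ridge N x0 D \<Longrightarrow> \<exists>\<psi>\<in>T. \<forall>x\<in>S. \<bar>\<phi> x - \<psi> x\<bar> \<le> (1 / 4) ^ Suc k"
proof -
  \<comment> \<open>Half of the precision is spent on the direction, half on the profile; \<open>m\<close> solves \<open>6 / m = \<delta>\<close>.\<close>
  define \<delta> :: real where "\<delta> = (1 / 4) ^ Suc k / 2"
  define m :: nat where "m = 48 * 4 ^ k"
  have \<delta>: "\<delta> > 0" by (simp add: \<delta>_def)
  have m: "m > 0" "6 / real m = \<delta>" by (simp_all add: m_def \<delta>_def power_one_over field_simps)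
  obtain \<Gamma> where \<Gamma>: "\<Gamma> \<subseteq> {g. N g = 1}" "finite \<Gamma>" "real (card \<Gamma>) \<le> (1 + 2 / \<delta>) ^ DIM('a)"
    "\<And>g. N g = 1 \<Longrightarrow> \<exists>h\<in>\<Gamma>. N (g - h) \<le> \<delta>"
    using is_norm_sphere_net[OF N \<delta>] by blast
  obtain U where U: "U \<subseteq> lipschitz_pinned" "finite U" "card U \<le> 3 ^ m"
    "\<And>f. f \<in> lipschitz_pinned \<Longrightarrow> \<exists>g\<in>U. \<forall>t\<in>{0..2}. \<bar>f t - g t\<bar> \<le> 6 / real m"
    using lipschitz_pinned_net[OF m(1)] by blast
  define T where "T = (\<lambda>(f, g) x. f ((x - x0) \<bullet> g / D + 1)) ` (U \<times> \<Gamma>)"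
  show ?thesis
  proof
    show "T \<subseteq> lipschitz_ridge N x0 D"
      unfolding T_def lipschitz_ridge_def using U(1) \<Gamma>(1) by auto
    show "finite T" using U(2) \<Gamma>(2) by (simp add: T_def)
    have "card T \<le> card U * card \<Gamma>"
      unfolding T_def using card_image_le[of "U \<times> \<Gamma>"] U(2) \<Gamma>(2) by (simp add: card_cartesian_product)
    then have "real (card T) \<le> real (card U) * real (card \<Gamma>)" by (metis of_nat_le_iff of_nat_mult)
    also have "\<dots> \<le> exp (96 * 4 ^ k) * exp (16 * real DIM('a) * 4 ^ k)"
    proof (intro mult_mono)
      have "real (card U) \<le> 3 ^ m" using U(3) by (metis of_nat_le_iff of_nat_numeral of_nat_power)
      also have "\<dots> \<le> exp 2 ^ m" using exp_ge_add_one_self[of 2] by (intro power_mono) auto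
      also have "\<dots> = exp (96 * 4 ^ k)" by (simp add: exp_of_nat_mult[symmetric] m_def)
      finally show "real (card U) \<le> exp (96 * 4 ^ k)" .
      have "real (card \<Gamma>) \<le> exp (16 * 4 ^ k) ^ DIM('a)"
      proof (rule order_trans[OF \<Gamma>(3)])
        have "2 / \<delta> = 16 * 4 ^ k" by (simp add: \<delta>_def power_one_over field_simps)
        then show "(1 + 2 / \<delta>) ^ DIM('a) \<le> exp (16 * 4 ^ k) ^ DIM('a)"
          by (intro power_mono) (auto simp: exp_ge_add_one_self)
      qed
      then show "real (card \<Gamma>) \<le> exp (16 * real DIM('a) * 4 ^ k)"
        by (simp add: exp_of_nat_mult[symmetric] algebra_simps)
    qed auto
    also have "\<dots> = exp ((96 + 16 * real DIM('a)) * 4 ^ k)"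
      by (simp add: exp_add[symmetric] algebra_simps)
    also have "\<dots> \<le> exp (64 * (real DIM('a) + 1) * 4 ^ k)"
    proof -
      have aux: "96 + 16 * y \<le> 64 * (y + 1)" if "1 \<le> y" for y :: real using that by simp
      have "1 \<le> real DIM('a)" using DIM_positive[where 'a='a] by linarith
      then have "(96 + 16 * real DIM('a)) * 4 ^ k \<le> 64 * (real DIM('a) + 1) * 4 ^ k"
        by (intro mult_right_mono aux) simp_all
      then show ?thesis by (simp only: exp_le_cancel_iff)
    qed
    finally show "real (card T) \<le> exp (64 * (real DIM('a) + 1) * 4 ^ k)" .
    fix \<phi> assume "\<phi> \<in> lipschitz_ridge N x0 D"
    then obtain f g where f: "f \<in> lipschitz_pinned" and g: "N g = 1" and \<phi>: "\<phi> = (\<lambda>x. f ((x - x0) \<bullet> g / D + 1))"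
      by (auto simp: lipschitz_ridge_def)
    obtain h where h: "h \<in> \<Gamma>" "N (g - h) \<le> \<delta>" using \<Gamma>(4)[OF g] by blast
    obtain e where e: "e \<in> U" "\<And>t. t \<in> {0..2} \<Longrightarrow> \<bar>f t - e t\<bar> \<le> \<delta>" using U(4)[OF f] m by auto
    have "\<bar>\<phi> x - e ((x - x0) \<bullet> h / D + 1)\<bar> \<le> (1 / 4) ^ Suc k" if x: "x \<in> S" for x
    proof -
      let ?s = "(x - x0) \<bullet> g / D + 1" and ?t = "(x - x0) \<bullet> h / D + 1"
      have "\<bar>f ?s - f ?t\<bar> \<le> \<bar>?s - ?t\<bar>" using f unfolding lipschitz_pinned_def by blast
      also have "?s - ?t = (x - x0) \<bullet> (g - h) / D"
        by (simp add: inner_diff_right diff_divide_distrib)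
      also have "\<bar>(x - x0) \<bullet> (g - h) / D\<bar> = \<bar>(x - x0) \<bullet> (g - h)\<bar> / D"
        using D by simp
      also have "\<dots> \<le> N (g - h)" using diam[OF x x0, of "g - h"] D by (simp add: field_simps)
      finally have 1: "\<bar>f ?s - f ?t\<bar> \<le> \<delta>" using h by simp
      have "\<bar>(x - x0) \<bullet> h\<bar> \<le> D" using diam[OF x x0, of h] h \<Gamma>(1) by auto
      then have "?t \<in> {0..2}" using D by (auto simp: abs_le_iff field_simps)
      then have "\<bar>f ?t - e ?t\<bar> \<le> \<delta>" by (rule e(2))
      then show ?thesis using 1 unfolding \<phi> \<delta>_def by linarith
    qed
    moreover have "(\<lambda>x. e ((x - x0) \<bullet> h / D + 1)) \<in> T" unfolding T_def using e h by force
    ultimately show "\<exists>\<psi>\<in>T. \<forall>x\<in>S. \<bar>\<phi> x - \<psi> x\<bar> \<le> (1 / 4) ^ Suc k"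
      by (intro bexI[of _ "\<lambda>x. e ((x - x0) \<bullet> h / D + 1)"] ballI)
  qed
qed


section \<open>Chaining\<close>

text \<open>Prescribing the failure probability as \<open>exp (- t)\<close> suits a union bound over a net: the logarithm of its cardinality
  is simply added to \<open>t\<close>.\<close>

lemma hoeffding_iid_bound:
  fixes X :: "nat \<Rightarrow> 'w \<Rightarrow> 'a::topological_space" and \<phi> :: "'a \<Rightarrow> real"
  assumes M: "prob_space M" and indep: "prob_space.indep_vars M (\<lambda>_. borel) X {..<n}"
    and distr: "\<And>i. i < n \<Longrightarrow> distr M borel (X i) = P" and n: "n \<ge> 1"
    and [measurable]: "\<phi> \<in> borel_measurable borel" 
    and S: "AE x in P. x \<in> S" and range: "\<And>x y. x \<in> S \<Longrightarrow> y \<in> S \<Longrightarrow> \<bar>\<phi> x - \<phi> y\<bar> \<le> c"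
    and c: "c > 0" and t: "t \<ge> 0"
  shows "measure M {\<omega>\<in>space M. (\<integral>x. \<phi> x \<partial>P) + c * sqrt (t / (2 * n)) \<le> (\<Sum>i<n. \<phi> (X i \<omega>)) / n} \<le> exp (- t)"
proof -
  interpret M: prob_space M by fact
  have X [measurable]: "X i \<in> M \<rightarrow>\<^sub>M borel" if "i < n" for i
    using indep that by (auto simp: M.indep_vars_def)
  have P: "P = distr M borel (X 0)" using distr[of 0] n by simp
  have X0 [measurable]: "X 0 \<in> M \<rightarrow>\<^sub>M borel" using X n by simp
  interpret P: prob_space P unfolding P by (rule M.prob_space_distr) simp
  obtain x0 where x0: "x0 \<in> S" using S P.AE_contr by (metis (mono_tags, lifting) eventually_mono)
  define a where "a = Inf (\<phi> ` S)"
  have bdd: "bdd_below (\<phi> ` S)"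
    using range[OF x0] by (intro bdd_belowI2[of _ "\<phi> x0 - c"]) (smt (verit))
  have ab: "\<phi> x \<in> {a..a + c}" if "x \<in> S" for x
  proof -
    have "a \<le> \<phi> x" unfolding a_def using bdd that by (intro cInf_lower) auto
    moreover have "\<phi> x - c \<le> a" unfolding a_def
      using x0 range[OF that] by (intro cInf_greatest) (auto simp: abs_le_iff algebra_simps)
    ultimately show ?thesis by simp
  qed
  interpret H: Hoeffding_ineq_iid M "{..<n}" "\<lambda>i \<omega>. \<phi> (X i \<omega>)" "\<lambda>\<omega>. \<phi> (X 0 \<omega>)" a "a + c" "M.expectation (\<lambda>\<omega>. \<phi> (X 0 \<omega>))"
  proof unfold_locales
    show "M.indep_vars (\<lambda>_. borel) (\<lambda>i \<omega>. \<phi> (X i \<omega>)) {..<n}"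
      by (rule M.indep_vars_compose2[OF indep]) simp
    show "distr M borel (\<lambda>\<omega>. \<phi> (X i \<omega>)) = distr M borel (\<lambda>\<omega>. \<phi> (X 0 \<omega>))" if "i \<in> {..<n}" for i
    proof -
      have "distr M borel (\<lambda>\<omega>. \<phi> (X j \<omega>)) = distr P borel \<phi>" if "j < n" for j
        using that by (subst distr[OF that, symmetric], subst distr_distr) (auto simp: o_def)
      then show ?thesis using that n by simp
    qed
    show "AE \<omega> in M. \<phi> (X 0 \<omega>) \<in> {a..a + c}"
    proof -
      have "AE x in P. \<phi> x \<in> {a..a + c}" using S by eventually_elim (rule ab)
      then show ?thesis unfolding P by (rule AE_distrD[rotated]) simp
    qed
  qed simp_all
  have "measure M {\<omega>\<in>space M. (\<Sum>i\<in>{..<n}. \<phi> (X i \<omega>)) / real (card {..<n}) \<ge> M.expectation (\<lambda>\<omega>. \<phi> (X 0 \<omega>)) + c * sqrt (t / (2 * n))}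
     \<le> exp (- 2 * real (card {..<n}) * (c * sqrt (t / (2 * n)))\<^sup>2 / (a + c - a)\<^sup>2)"
    by (rule H.Hoeffding_ineq_ge') (use c t n in \<open>auto simp: lessThan_empty_iff\<close>)
  also have "- 2 * real (card {..<n}) * (c * sqrt (t / (2 * n)))\<^sup>2 / (a + c - a)\<^sup>2 = - t"
    using c t n by (simp add: power_mult_distrib field_simps)
  also have "M.expectation (\<lambda>\<omega>. \<phi> (X 0 \<omega>)) = (\<integral>x. \<phi> x \<partial>P)"
    unfolding P by (subst integral_distr) auto
  finally show ?thesis by simp
qed

text \<open>A member of \<open>F\<close> is reached from \<open>G 0\<close> through nets of increasing precision. The increment from level
  \<open>j\<close> to \<open>j + 1\<close> oscillates by at most \<open>2 \<epsilon> j\<close>, so Hoeffding's inequality is the stronger the finer the level, and compensates for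
  the growing number of increments. All the inequalities hold together with probability \<open>1 - \<alpha>\<close>, whence a tail bound without a
  separate concentration argument. Requiring \<open>G k \<subseteq> F\<close> keeps the oscillation of the first link at \<open>1\<close>.\<close>

lemma chaining_deviation_bound:
  fixes X :: "nat \<Rightarrow> 'w \<Rightarrow> 'a::topological_space" and F :: "('a \<Rightarrow> real) set"
  assumes M: "prob_space M" and indep: "prob_space.indep_vars M (\<lambda>_. borel) X {..<n}"
    and distr: "\<And>i. i < n \<Longrightarrow> distr M borel (X i) = P" and n: "n \<ge> 1"
    and S: "S \<in> sets borel" "AE x in P. x \<in> S" 
    and F_meas: "\<And>f. f \<in> F \<Longrightarrow> f \<in> borel_measurable borel"
    and F_range: "\<And>f x y. f \<in> F \<Longrightarrow> x \<in> S \<Longrightarrow> y \<in> S \<Longrightarrow> \<bar>f x - f y\<bar> \<le> 1"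
    and G: "\<And>k. G k \<subseteq> F" "\<And>k. finite (G k)" "\<And>k. real (card (G k)) \<le> exp (H k)" "\<And>k. H k \<ge> 0"
    and net: "\<And>k f. f \<in> F \<Longrightarrow> \<exists>g\<in>G k. \<forall>x\<in>S. \<bar>f x - g x\<bar> \<le> \<epsilon> k" and \<epsilon>: "\<And>k. \<epsilon> k > 0"
    and \<alpha>: "0 < \<alpha>" "\<alpha> < 1"
  defines "c \<equiv> \<lambda>k. case k of 0 \<Rightarrow> 1 | Suc j \<Rightarrow> 2 * \<epsilon> j"
    and "\<tau> \<equiv> \<lambda>k. H k + (real k + 1) * ln 2 + ln (1 / \<alpha>)"
  shows "\<exists>A\<in>sets M. measure M A \<ge> 1 - \<alpha> \<and> (\<forall>\<omega>\<in>A. (\<forall>i<n. X i \<omega> \<in> S) \<and>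
     (\<forall>f\<in>F. (\<Sum>i<n. f (X i \<omega>)) / n - (\<integral>x. f x \<partial>P) \<le> (\<Sum>k\<le>K. c k * sqrt (\<tau> k / (2 * n))) + 2 * \<epsilon> K))"
proof -
  interpret M: prob_space M by fact
  have X [measurable]: "X i \<in> M \<rightarrow>\<^sub>M borel" if "i < n" for i
    using indep that by (auto simp: M.indep_vars_def)
  have P: "P = distr M borel (X 0)" using distr[of 0] n by simp
  have X0: "X 0 \<in> M \<rightarrow>\<^sub>M borel" using X n by simp
  interpret P: prob_space P unfolding P by (rule M.prob_space_distr) (rule X0)
  have [measurable_cong]: "sets P = sets borel" by (simp add: P)
  have [measurable]: "S \<in> sets borel" by fact
  define dev where "dev f \<omega> = (\<Sum>i<n. f (X i \<omega>)) / n - (\<integral>x. f x \<partial>P)" for f :: "'a \<Rightarrow> real" and \<omega>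
  obtain x0 where x0: "x0 \<in> S" using S P.AE_contr by (metis (mono_tags, lifting) eventually_mono)
  have int: "integrable P f" if "f \<in> F" for f
  proof (rule P.integrable_const_bound[of _ "\<bar>f x0\<bar> + 1"])
    show "AE x in P. norm (f x) \<le> \<bar>f x0\<bar> + 1"
      using S(2) by eventually_elim (use F_range[OF that _ x0] in \<open>smt (verit) real_norm_def\<close>)
  qed (use F_meas[OF that] in simp)
  have dev_diff: "dev (\<lambda>x. f x - g x) \<omega> = dev f \<omega> - dev g \<omega>" if "f \<in> F" "g \<in> F" for f g \<omega>
    using int that by (simp add: dev_def sum_subtractf diff_divide_distrib)
  define near where "near k f = (SOME g. g \<in> G k \<and> (\<forall>x\<in>S. \<bar>f x - g x\<bar> \<le> \<epsilon> k))" for k f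
  have near: "near k f \<in> G k \<and> (\<forall>x\<in>S. \<bar>f x - near k f x\<bar> \<le> \<epsilon> k)" if "f \<in> F" for k f
    unfolding near_def by (rule someI_ex[OF net[OF that, of k, unfolded Bex_def]])
  \<comment> \<open>The links of level \<open>k\<close>. Each point of \<open>G (Suc j)\<close> has a single parent in \<open>G j\<close>, hence no more links than points.\<close>
  define L where "L k = (case k of 0 \<Rightarrow> G 0 | Suc j \<Rightarrow> (\<lambda>g x. g x - near j g x) ` G (Suc j))" for k
  have L_fin: "finite (L k)" for k using G(2) by (auto simp: L_def split: nat.splits)
  have L_card: "real (card (L k)) \<le> exp (H k)" for k
  proof (cases k)
    case (Suc j)
    have "card (L k) \<le> card (G k)" unfolding L_def Suc using card_image_le[OF G(2)] by simp
    then show ?thesis using G(3)[of k] by linarith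
  qed (use G(3) in \<open>simp add: L_def\<close>)
  have L_meas: "\<phi> \<in> borel_measurable borel" if "\<phi> \<in> L k" for \<phi> k
    using that G(1) near F_meas unfolding L_def
    by (auto split: nat.splits intro!: borel_measurable_diff) blast+
  have L_range: "\<bar>\<phi> x - \<phi> y\<bar> \<le> c k" if in_L: "\<phi> \<in> L k" and xy: "x \<in> S" "y \<in> S" for \<phi> k x y
  proof (cases k)
    case 0
    then have "\<phi> \<in> F" using in_L G(1)[of 0] by (auto simp: L_def)
    then show ?thesis using F_range[OF _ xy] 0 by (simp add: c_def)
  next
    case (Suc j)
    then obtain g where g: "g \<in> G (Suc j)" "\<phi> = (\<lambda>x. g x - near j g x)" using in_L by (auto simp: L_def)
    then have "\<bar>\<phi> z\<bar> \<le> \<epsilon> j" if "z \<in> S" for z using near[of g j] G(1)[of "Suc j"] that by auto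
    from this[OF xy(1)] this[OF xy(2)] show ?thesis using Suc by (simp add: c_def)
  qed
  have c_pos: "c k > 0" for k using \<epsilon> by (auto simp: c_def split: nat.splits)
  have \<tau>_pos: "\<tau> k \<ge> 0" for k using G(4)[of k] \<alpha> by (simp add: \<tau>_def)
  define bad where "bad k \<phi> = {\<omega>\<in>space M. (\<integral>x. \<phi> x \<partial>P) + c k * sqrt (\<tau> k / (2 * n)) \<le> (\<Sum>i<n. \<phi> (X i \<omega>)) / n}" for k \<phi>
  have bad_sets: "bad k \<phi> \<in> sets M" if "\<phi> \<in> L k" for k \<phi>
  proof -
    have [measurable]: "\<phi> \<in> borel_measurable borel" using L_meas[OF that] .
    have [measurable]: "(\<lambda>\<omega>. \<Sum>i<n. \<phi> (X i \<omega>)) \<in> borel_measurable M"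
      by (rule borel_measurable_sum) simp
    show ?thesis unfolding bad_def by measurable
  qed
  have bad_prob: "measure M (bad k \<phi>) \<le> exp (- \<tau> k)" if "\<phi> \<in> L k" for k \<phi>
    unfolding bad_def
    using hoeffding_iid_bound[OF M indep distr n L_meas[OF that] S(2) L_range[OF that] c_pos[of k] \<tau>_pos[of k]] by simp
  define B where "B k = (\<Union>\<phi>\<in>L k. bad k \<phi>)" for k
  have B_sets: "B k \<in> sets M" for k
    unfolding B_def using L_fin bad_sets by (intro sets.finite_UN) auto
  \<comment> \<open>The entropy \<open>H k\<close> in \<open>\<tau> k\<close> pays for the union over the links, the term \<open>(k + 1) ln 2\<close> for the union over the levels.\<close>
  have B_prob: "measure M (B k) \<le> \<alpha> * (1/2)^(Suc k)" for k
  proof -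
    have "measure M (B k) \<le> (\<Sum>\<phi>\<in>L k. measure M (bad k \<phi>))"
      unfolding B_def using L_fin bad_sets by (intro M.finite_measure_subadditive_finite) auto
    also have "\<dots> \<le> real (card (L k)) * exp (- \<tau> k)"
      using sum_mono[of "L k" "\<lambda>\<phi>. measure M (bad k \<phi>)" "\<lambda>_. exp (- \<tau> k)"] bad_prob by simp
    also have "\<dots> \<le> exp (H k) * exp (- \<tau> k)"
      using L_card by (intro mult_right_mono) auto
    also have "\<dots> = exp (- (real (Suc k) * ln 2) - ln (1 / \<alpha>))"
      by (simp add: \<tau>_def exp_add[symmetric])
    also have "\<dots> = \<alpha> * (1/2)^(Suc k)"
      using \<alpha> by (simp add: exp_diff exp_minus exp_of_nat_mult[of _ "ln 2"] field_simps exp_add ln_div)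
    finally show ?thesis .
  qed
  define Z where "Z = {\<omega>\<in>space M. \<exists>i<n. X i \<omega> \<notin> S}"
  have Z_sets: "Z \<in> sets M"
  proof -
    have "Z = (\<Union>i<n. {\<omega>\<in>space M. X i \<omega> \<notin> S})" by (auto simp: Z_def)
    also have "\<dots> \<in> sets M"
      by (rule sets.finite_UN) (auto intro!: measurable_sets_Collect[OF X])
    finally show ?thesis .
  qed
  have Z_prob: "measure M Z = 0"
  proof -
    have "AE \<omega> in M. X i \<omega> \<in> S" if "i < n" for i
      using S(2) unfolding distr[OF that, symmetric] by (rule AE_distrD[OF X[OF that]])
    then have "AE \<omega> in M. \<forall>i\<in>{..<n}. X i \<omega> \<in> S" by (intro AE_finite_allI) auto
    then have "AE \<omega> in M. \<omega> \<notin> Z" by eventually_elim (auto simp: Z_def)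
    then show ?thesis using Z_sets by (simp add: M.prob_eq_0)
  qed
  define A where "A = space M - ((\<Union>k\<le>K. B k) \<union> Z)"
  have U_sets: "(\<Union>k\<le>K. B k) \<in> sets M" using B_sets by auto
  have "measure M (\<Union>k\<le>K. B k) \<le> (\<Sum>k\<le>K. measure M (B k))"
    using B_sets by (intro M.finite_measure_subadditive_finite) auto
  also have "\<dots> \<le> (\<Sum>k\<le>K. \<alpha> * (1/2)^(Suc k))" by (rule sum_mono) (rule B_prob)
  also have "\<dots> = \<alpha> * (1 - (1/2)^(Suc K))"
    by (induction K) (simp_all add: field_simps)
  also have "\<dots> \<le> \<alpha>" using \<alpha> by simp
  finally have "measure M ((\<Union>k\<le>K. B k) \<union> Z) \<le> \<alpha>"
    using measure_Un_le[OF U_sets Z_sets] Z_prob by linarith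
  then have A_prob: "measure M A \<ge> 1 - \<alpha>"
    unfolding A_def using U_sets Z_sets by (subst M.prob_compl) auto
  have A_sets: "A \<in> sets M" unfolding A_def using U_sets Z_sets by auto
  have A_dev: "dev \<phi> \<omega> \<le> c k * sqrt (\<tau> k / (2 * n))" if "\<omega> \<in> A" "k \<le> K" "\<phi> \<in> L k" for \<omega> k \<phi>
  proof -
    have "\<omega> \<notin> bad k \<phi>" "\<omega> \<in> space M" using that by (auto simp: A_def B_def)
    then show ?thesis by (simp add: bad_def dev_def)
  qed
  have chain: "dev g \<omega> \<le> (\<Sum>j\<le>k. c j * sqrt (\<tau> j / (2 * n)))" if "\<omega> \<in> A" "k \<le> K" "g \<in> G k" for g k \<omega>
    using that(2,3)
  proof (induction k arbitrary: g)
    case 0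
    then show ?case using A_dev[OF that(1), of 0 g] by (simp add: L_def)
  next
    case (Suc k)
    have gF: "g \<in> F" using Suc.prems G(1) by auto
    have nF: "near k g \<in> G k" using near[OF gF] by simp
    have "dev g \<omega> = dev (\<lambda>x. g x - near k g x) \<omega> + dev (near k g) \<omega>"
      using nF G(1) by (subst dev_diff[OF gF]) auto
    also have "\<dots> \<le> c (Suc k) * sqrt (\<tau> (Suc k) / (2 * n)) + (\<Sum>j\<le>k. c j * sqrt (\<tau> j / (2 * n)))"
      using Suc nF by (intro add_mono A_dev[OF that(1)]) (auto simp: L_def)
    finally show ?case by simp
  qed
  have "dev f \<omega> \<le> (\<Sum>k\<le>K. c k * sqrt (\<tau> k / (2 * n))) + 2 * \<epsilon> K" if \<omega>: "\<omega> \<in> A" and f: "f \<in> F" for f \<omega>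
  proof -
    have g: "near K f \<in> G K" "near K f \<in> F" "\<And>x. x \<in> S \<Longrightarrow> \<bar>f x - near K f x\<bar> \<le> \<epsilon> K"
      using near[OF f] G(1) by auto
    have XS: "X i \<omega> \<in> S" if "i < n" for i using \<omega> that by (auto simp: A_def Z_def)
    have "(\<Sum>i<n. f (X i \<omega>) - near K f (X i \<omega>)) \<le> (\<Sum>i<n. \<epsilon> K)"
      by (rule sum_mono) (use g(3) XS in \<open>auto simp: abs_le_iff\<close>)
    then have 1: "(\<Sum>i<n. f (X i \<omega>) - near K f (X i \<omega>)) / n \<le> \<epsilon> K" using n by (simp add: field_simps)
    have "(\<integral>x. - \<epsilon> K \<partial>P) \<le> (\<integral>x. f x - near K f x \<partial>P)"
    proof (rule integral_mono_AE)
      show "AE x in P. - \<epsilon> K \<le> f x - near K f x"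
        using S(2) by eventually_elim (use g(3) in \<open>smt (verit)\<close>)
    qed (use int[OF f] int[OF g(2)] in auto)
    then have "dev (\<lambda>x. f x - near K f x) \<omega> \<le> 2 * \<epsilon> K" using 1 by (simp add: dev_def P.prob_space)
    then show ?thesis using chain[OF \<omega> _ g(1)] dev_diff[OF f g(2), of \<omega>] by simp
  qed
  moreover have "X i \<omega> \<in> S" if "\<omega> \<in> A" "i < n" for i \<omega> using that by (auto simp: A_def Z_def)
  ultimately show ?thesis using A_sets A_prob
    by (intro bexI[of _ A] conjI ballI allI impI) (simp_all add: dev_def)
qed

text \<open>The level-\<open>k\<close> term is of size \<open>4\<^sup>-\<^sup>k\<close> times the root \<open>2\<^sup>k\<close> of the entropy, hence the series is geometric. The
  oscillations alone add up to at most \<open>2\<close>, which is what yields the coefficient \<open>1\<close> of \<open>sqrt (2 * L)\<close>.\<close>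

lemma chaining_sum_bound:
  fixes d n K :: nat and L :: real
  assumes n: "n \<ge> 1" and L: "L \<ge> 0"
  defines "c \<equiv> \<lambda>k. case k of 0 \<Rightarrow> 1 | Suc j \<Rightarrow> 2 * (1 / 4) ^ Suc j"
    and "\<tau> \<equiv> \<lambda>k. 64 * (real d + 2) * 4 ^ k + (real k + 1) * ln 2 + L"
  shows "(\<Sum>k\<le>K. c k * sqrt (\<tau> k / (2 * real n))) \<le> (18 * sqrt (real d + 2) + sqrt (2 * L)) / sqrt n"
proof -
  have c_nonneg: "c k \<ge> 0" for k by (simp add: c_def split: nat.splits)
  have sum_c: "(\<Sum>k\<le>K. c k) \<le> 2 - (1 / 4) ^ K"
  proof (induction K)
    case (Suc K)
    have "(\<Sum>k\<le>Suc K. c k) = (\<Sum>k\<le>K. c k) + (1 / 4) ^ K / 2" "(1 / 4) ^ Suc K = (1 / 4) ^ K / (4 :: real)"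
      by (simp_all add: c_def)
    moreover have "(0::real) \<le> (1 / 4) ^ K" by simp
    ultimately show ?case using Suc by linarith
  qed (simp add: c_def)
  have sum_c2: "(\<Sum>k\<le>K. c k * 2 ^ k) \<le> 3 - 2 * (1 / 2) ^ K"
  proof (induction K)
    case (Suc K)
    have "(1 / 4) ^ K * 2 ^ K = ((1 / 2) ^ K :: real)"
      by (simp flip: power_mult_distrib)
    then have "(\<Sum>k\<le>Suc K. c k * 2 ^ k) = (\<Sum>k\<le>K. c k * 2 ^ k) + (1 / 2) ^ K"
      by (simp add: c_def)
    moreover have "2 * (1 / 2) ^ Suc K = ((1 / 2) ^ K :: real)" by simp
    ultimately show ?case using Suc by linarith
  qed (simp add: c_def)
  have term_le: "sqrt (\<tau> k / (2 * real n)) \<le> (6 * 2 ^ k * sqrt (real d + 2) + sqrt (2 * L) / 2) / sqrt n" for k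
  proof -
    have "(real k + 1) * ln 2 \<le> real k + 1"
      using ln_2_less_1 by (simp add: mult_left_le)
    also have "\<dots> \<le> 4 ^ k" by (induction k) auto
    also have "\<dots> \<le> (real d + 2) * 4 ^ k" by (simp add: mult_right_mono[of 1])
    finally have le: "(real k + 1) * ln 2 \<le> (real d + 2) * 4 ^ k" .
    have "\<tau> k / 2 \<le> 36 * ((real d + 2) * 4 ^ k) + L / 2"
    proof -
      have "0 \<le> (real d + 2) * 4 ^ k" by simp
      moreover have "\<tau> k = 64 * ((real d + 2) * 4 ^ k) + (real k + 1) * ln 2 + L"
        by (simp add: \<tau>_def)
      ultimately show ?thesis using le by linarith
    qed
    then have "sqrt (\<tau> k / 2) \<le> sqrt (36 * ((real d + 2) * 4 ^ k) + L / 2)"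
      by (rule real_sqrt_le_mono)
    also have "\<dots> \<le> sqrt (36 * ((real d + 2) * 4 ^ k)) + sqrt (L / 2)"
      by (rule sqrt_add_le_add_sqrt) (use L in simp_all)
    also have "sqrt (36 * ((real d + 2) * 4 ^ k)) = 6 * 2 ^ k * sqrt (real d + 2)"
    proof -
      have "(2 ^ k)\<^sup>2 = (4 :: real) ^ k" by (simp add: power2_eq_square flip: power_mult_distrib)
      then have "36 * ((real d + 2) * 4 ^ k) = (6 * 2 ^ k)\<^sup>2 * (real d + 2)"
        by (simp add: power_mult_distrib)
      then show ?thesis by (simp add: real_sqrt_mult)
    qed
    also have "sqrt (L / 2) = sqrt (2 * L) / 2"
      using real_sqrt_divide[of "2 * L" 4] by simp
    finally have "sqrt (\<tau> k / 2) \<le> 6 * 2 ^ k * sqrt (real d + 2) + sqrt (2 * L) / 2" .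
    moreover have "sqrt (\<tau> k / (2 * real n)) = sqrt (\<tau> k / 2) / sqrt n"
      by (simp add: real_sqrt_divide[symmetric])
    ultimately show ?thesis using n by (simp add: divide_right_mono)
  qed
  have "(\<Sum>k\<le>K. c k * sqrt (\<tau> k / (2 * real n))) \<le> (\<Sum>k\<le>K. c k * ((6 * 2 ^ k * sqrt (real d + 2) + sqrt (2 * L) / 2) / sqrt n))"
    by (intro sum_mono mult_left_mono term_le c_nonneg)
  also have "\<dots> = (\<Sum>k\<le>K. (c k * 2 ^ k) * (6 * sqrt (real d + 2) / sqrt n) + c k * (sqrt (2 * L) / 2 / sqrt n))"
    by (intro sum.cong refl) (simp add: add_divide_distrib algebra_simps)
  also have "\<dots> = (\<Sum>k\<le>K. c k * 2 ^ k) * (6 * sqrt (real d + 2) / sqrt n) + (\<Sum>k\<le>K. c k) * (sqrt (2 * L) / 2 / sqrt n)"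
    by (simp only: sum.distrib sum_distrib_right)
  also have "\<dots> \<le> 3 * (6 * sqrt (real d + 2) / sqrt n) + 2 * (sqrt (2 * L) / 2 / sqrt n)"
  proof (intro add_mono mult_right_mono)
    show "(\<Sum>k\<le>K. c k * 2 ^ k) \<le> 3" by (rule order_trans[OF sum_c2]) simp
    show "(\<Sum>k\<le>K. c k) \<le> 2" by (rule order_trans[OF sum_c]) simp
  qed (use L in auto)
  also have "\<dots> = (18 * sqrt (real d + 2) + sqrt (2 * L)) / sqrt n"
    by (simp add: add_divide_distrib)
  finally show ?thesis .
qed

text \<open>Uniform law of large numbers at the parametric rate: at precision \<open>\<epsilon>\<close> the entropy is of order \<open>1 / \<epsilon>\<close>,
  whose square root is integrable at \<open>0\<close>, so no logarithm of \<open>n\<close> appears.\<close>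

lemma lipschitz_ridge_deviation:
  fixes N :: "'a::euclidean_space \<Rightarrow> real" and X :: "nat \<Rightarrow> 'w \<Rightarrow> 'a"
  assumes N: "is_norm N" and D: "D > 0"
    and diam: "\<And>x y g. x \<in> S \<Longrightarrow> y \<in> S \<Longrightarrow> \<bar>(x - y) \<bullet> g\<bar> \<le> D * N g" and x0: "x0 \<in> S"
    and M: "prob_space M" and indep: "prob_space.indep_vars M (\<lambda>_. borel) X {..<n}"
    and distr: "\<And>i. i < n \<Longrightarrow> distr M borel (X i) = P" and n: "n \<ge> 1"
    and S: "S \<in> sets borel" "AE x in P. x \<in> S" and \<alpha>: "0 < \<alpha>" "\<alpha> < 1" and d: "DIM('a) = d + 1"
  shows "\<exists>A\<in>sets M. measure M A \<ge> 1 - \<alpha> \<and> (\<forall>\<omega>\<in>A. (\<forall>i<n. X i \<omega> \<in> S) \<and>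
     (\<forall>\<phi>\<in>lipschitz_ridge N x0 D. (\<Sum>i<n. \<phi> (X i \<omega>)) / n - (\<integral>x. \<phi> x \<partial>P)
        \<le> (19 * sqrt (real d + 2) + sqrt (2 * ln (1 / \<alpha>))) / sqrt n))"
proof -
  let ?F = "lipschitz_ridge N x0 D"
  define \<epsilon> :: "nat \<Rightarrow> real" where "\<epsilon> k = (1 / 4) ^ Suc k" for k
  define H :: "nat \<Rightarrow> real" where "H k = 64 * (real d + 2) * 4 ^ k" for k
  have "\<exists>T. T \<subseteq> ?F \<and> finite T \<and> real (card T) \<le> exp (H k) \<and>
    (\<forall>\<phi>\<in>?F. \<exists>\<psi>\<in>T. \<forall>x\<in>S. \<bar>\<phi> x - \<psi> x\<bar> \<le> \<epsilon> k)" for k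
  proof -
    obtain T where T: "T \<subseteq> ?F" "finite T" "real (card T) \<le> exp (64 * (real DIM('a) + 1) * 4 ^ k)"
      "\<And>\<phi>. \<phi> \<in> ?F \<Longrightarrow> \<exists>\<psi>\<in>T. \<forall>x\<in>S. \<bar>\<phi> x - \<psi> x\<bar> \<le> (1 / 4) ^ Suc k"
      by (rule lipschitz_ridge_net[OF N D diam x0]) blast+
    have "64 * (real DIM('a) + 1) * 4 ^ k = H k" by (simp add: H_def d)
    then show ?thesis using T unfolding \<epsilon>_def by auto
  qed
  then obtain G where G: "G k \<subseteq> ?F" "finite (G k)" "real (card (G k)) \<le> exp (H k)"
    "\<And>\<phi>. \<phi> \<in> ?F \<Longrightarrow> \<exists>\<psi>\<in>G k. \<forall>x\<in>S. \<bar>\<phi> x - \<psi> x\<bar> \<le> \<epsilon> k" for k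
    by metis
  have F_meas: "\<phi> \<in> borel_measurable borel" if "\<phi> \<in> ?F" for \<phi>
    by (rule lipschitz_ridge_measurable[OF D that])
  have F_range: "\<bar>\<phi> x - \<phi> y\<bar> \<le> 1" if "\<phi> \<in> ?F" "x \<in> S" "y \<in> S" for \<phi> x y
    using lipschitz_ridge_range[OF D diam that] .
  \<comment> \<open>After \<open>n\<close> levels the approximation error is far below \<open>1 / sqrt n\<close>, so the chain may stop there.\<close>
  let ?c = "\<lambda>k. case k of 0 \<Rightarrow> 1 | Suc j \<Rightarrow> 2 * \<epsilon> j"
  let ?\<tau> = "\<lambda>k. H k + (real k + 1) * ln 2 + ln (1 / \<alpha>)"
  have "(\<Sum>k\<le>n. ?c k * sqrt (?\<tau> k / (2 * real n))) + 2 * \<epsilon> n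
      \<le> (18 * sqrt (real d + 2) + sqrt (2 * ln (1 / \<alpha>))) / sqrt n + 1 / sqrt n"
  proof (rule add_mono)
    show "(\<Sum>k\<le>n. ?c k * sqrt (?\<tau> k / (2 * real n))) \<le> (18 * sqrt (real d + 2) + sqrt (2 * ln (1 / \<alpha>))) / sqrt n"
      using chaining_sum_bound[OF n, of "ln (1 / \<alpha>)" d n] \<alpha> unfolding \<epsilon>_def H_def by simp
    have "real n + 1 \<le> 4 ^ n" by (induction n) auto
    moreover have "sqrt n \<le> n" using n by (simp add: real_sqrt_le_iff' sqrt_le_D real_le_lsqrt power2_eq_square)
    ultimately have "1 / 4 ^ n \<le> 1 / sqrt n" using n by (intro divide_left_mono) auto
    moreover have "2 * \<epsilon> n \<le> 1 / 4 ^ n"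
      unfolding \<epsilon>_def power_one_over by (simp add: field_simps)
    ultimately show "2 * \<epsilon> n \<le> 1 / sqrt n" by linarith
  qed
  also have "\<dots> \<le> (19 * sqrt (real d + 2) + sqrt (2 * ln (1 / \<alpha>))) / sqrt n"
  proof -
    have "1 \<le> sqrt (real d + 2)" by simp
    then have "18 * sqrt (real d + 2) + sqrt (2 * ln (1 / \<alpha>)) + 1 \<le> 19 * sqrt (real d + 2) + sqrt (2 * ln (1 / \<alpha>))"
      by linarith
    then show ?thesis unfolding add_divide_distrib[symmetric] by (rule divide_right_mono) simp
  qed
  finally have bound: "(\<Sum>k\<le>n. ?c k * sqrt (?\<tau> k / (2 * real n))) + 2 * \<epsilon> n \<le> (19 * sqrt (real d + 2) + sqrt (2 * ln (1 / \<alpha>))) / sqrt n" .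
  have H: "H k \<ge> 0" for k by (simp add: H_def)
  have \<epsilon>: "\<epsilon> k > 0" for k by (simp add: \<epsilon>_def)
  obtain A where A: "A \<in> sets M" "measure M A \<ge> 1 - \<alpha>"
    and A_dev: "\<forall>\<omega>\<in>A. (\<forall>i<n. X i \<omega> \<in> S) \<and> (\<forall>\<phi>\<in>?F. (\<Sum>i<n. \<phi> (X i \<omega>)) / n - (\<integral>x. \<phi> x \<partial>P)
      \<le> (\<Sum>k\<le>n. ?c k * sqrt (?\<tau> k / (2 * real n))) + 2 * \<epsilon> n)"
  proof -
    have "\<exists>A\<in>sets M. measure M A \<ge> 1 - \<alpha> \<and> (\<forall>\<omega>\<in>A. (\<forall>i<n. X i \<omega> \<in> S) \<and>
      (\<forall>\<phi>\<in>?F. (\<Sum>i<n. \<phi> (X i \<omega>)) / n - (\<integral>x. \<phi> x \<partial>P)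
        \<le> (\<Sum>k\<le>n. ?c k * sqrt (?\<tau> k / (2 * real n))) + 2 * \<epsilon> n))"
      by (rule chaining_deviation_bound[where G = G])
         (fact M indep distr n S F_meas F_range G H \<epsilon> \<alpha>)+
    then show ?thesis using that by blast
  qed
  have "(\<Sum>i<n. \<phi> (X i \<omega>)) / n - (\<integral>x. \<phi> x \<partial>P) \<le> (19 * sqrt (real d + 2) + sqrt (2 * ln (1 / \<alpha>))) / sqrt n"
    if "\<omega> \<in> A" "\<phi> \<in> ?F" for \<omega> \<phi>
    by (rule order_trans[OF _ bound]) (use A_dev that in blast)
  then show ?thesis using A A_dev by (intro bexI[of _ A] conjI ballI) auto
qed


section \<open>The confidence bound\<close>

text \<open>The complement of the support is a union of open null sets, by second countability of countably many.\<close>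

lemma AE_measure_support:
  fixes P :: "'a::second_countable_topology measure"
  assumes sets: "sets P = sets borel"
  shows "AE x in P. x \<in> measure_support P"
proof -
  obtain B :: "'a set set" where B: "countable B" "topological_basis B"
    using ex_countable_basis by blast
  define Z where "Z = \<Union>{U\<in>B. emeasure P U = 0}"
  have "(\<Union>U\<in>{U\<in>B. emeasure P U = 0}. U) \<in> null_sets P"
  proof (rule null_sets_UN')
    show "countable {U\<in>B. emeasure P U = 0}" using B(1) by simp
    fix U assume "U \<in> {U\<in>B. emeasure P U = 0}"
    then show "U \<in> null_sets P"
      using topological_basis_open[OF B(2)] sets by (auto simp: null_sets_def)
  qed
  then have "Z \<in> null_sets P" by (simp add: Z_def)
  moreover have "x \<in> Z" if x: "x \<notin> measure_support P" for x
  proof -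
    obtain U where "open U" "x \<in> U" "\<not> emeasure P U > 0"
      using x unfolding measure_support_def by blast
    then have U: "open U" "x \<in> U" "emeasure P U = 0" by (simp_all add: not_gr_zero)
    obtain V where V: "V \<in> B" "x \<in> V" "V \<subseteq> U" by (rule topological_basisE[OF B(2) U(1,2)])
    have "emeasure P V \<le> emeasure P U" using U V sets by (intro emeasure_mono) auto
    then show ?thesis using U V by (auto simp: Z_def)
  qed
  ultimately show ?thesis by (intro AE_I'[of Z]) auto
qed

theorem theorem2:
  fixes r \<alpha> C :: real
    and d n :: nat
    and N :: "real ^ 'k \<Rightarrow> real"
    and P :: "(real ^ 'k) measure"
    and M :: "'w measure"
    and X :: "nat \<Rightarrow> 'w \<Rightarrow> real ^ 'k"
  assumes "r \<ge> 1"
    and "0 < \<alpha>" and "\<alpha> < 1"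
    and "CARD('k) = d + 1"
    and "is_norm N"
    and "prob_space P" and "sets P = sets borel"
    and "compact (measure_support P)"
    and "n \<ge> 1"
    and "prob_space M"
    and "prob_space.indep_vars M (\<lambda>_. borel) X {..<n}"
    and "\<And>i. i < n \<Longrightarrow> distr M borel (X i) = P"
  defines "C \<equiv> (180 * sqrt (real d + 2) + sqrt (2 * ln (1 / \<alpha>))) *
                 norm_diam (dual_norm N) (measure_support P) powr r"
  shows "measure M {\<omega> \<in> space M.
           epowr (max_sliced_wasserstein r N (empirical_measure n (\<lambda>i. X i \<omega>)) P) r
             \<le> ennreal (C / sqrt (real n))} \<ge> 1 - \<alpha>"
proof -
  note r = \<open>r \<ge> 1\<close> and \<alpha> = \<open>0 < \<alpha>\<close> \<open>\<alpha> < 1\<close> and N = \<open>is_norm N\<close>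
    and n = \<open>n \<ge> 1\<close> and M = \<open>prob_space M\<close> and iid = assms(11,12)
  define S where "S = measure_support P"
  define D where "D = norm_diam (dual_norm N) S"
  define \<kappa> where "\<kappa> = (180 * sqrt (real d + 2) + sqrt (2 * ln (1 / \<alpha>))) / sqrt n"
  interpret M: prob_space M by (rule M)
  interpret P: prob_space P by fact
  have compS: "compact S" using assms(8) by (simp add: S_def)
  have S: "S \<in> sets borel" "AE x in P. x \<in> S"
    using borel_closed[OF compact_imp_closed[OF compS]] AE_measure_support[OF assms(7)] by (simp_all add: S_def)
  obtain x0 where x0: "x0 \<in> S" using S P.AE_contr by (metis (mono_tags, lifting) eventually_mono)
  have diam: "\<bar>(x - y) \<bullet> g\<bar> \<le> D * N g" if "x \<in> S" "y \<in> S" for x y g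
    unfolding D_def by (rule inner_diff_le_norm_diam[OF N compact_imp_bounded[OF compS] that])
  have D0: "D \<ge> 0"
  proof -
    obtain g where "N g = 1" using is_norm_sphere_nonempty[OF N] by auto
    then show ?thesis using diam[OF x0 x0, of g] by simp
  qed
  have \<kappa>0: "\<kappa> \<ge> 0" using \<alpha> by (simp add: \<kappa>_def)
  have C: "C / sqrt n = \<kappa> * D powr r" by (simp add: C_def \<kappa>_def D_def S_def)
  \<comment> \<open>Ridge functions are normalised by the diameter. If it vanishes, any positive normaliser will do:
    the good event then only serves to place the sample in the support, where all projections agree.\<close>
  define D' where "D' = (if D = 0 then 1 else D)"
  have D': "D' > 0" "D \<le> D'" using D0 by (auto simp: D'_def)
  have diam': "\<bar>(x - y) \<bullet> g\<bar> \<le> D' * N g" if "x \<in> S" "y \<in> S" for x y g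
    using diam[OF that, of g] mult_right_mono[OF D'(2) is_norm_nonneg[OF N, of g]] by linarith
  have dim: "DIM(real ^ 'k) = d + 1" using assms(4) by simp
  obtain A where A: "A \<in> sets M" "measure M A \<ge> 1 - \<alpha>"
    and AX: "\<And>\<omega> i. \<omega> \<in> A \<Longrightarrow> i < n \<Longrightarrow> X i \<omega> \<in> S"
    and Adev: "\<And>\<omega> \<phi>. \<omega> \<in> A \<Longrightarrow> \<phi> \<in> lipschitz_ridge N x0 D' \<Longrightarrow>
      (\<Sum>i<n. \<phi> (X i \<omega>)) / n - (\<integral>x. \<phi> x \<partial>P)
        \<le> (19 * sqrt (real d + 2) + sqrt (2 * ln (1 / \<alpha>))) / sqrt n"
    using lipschitz_ridge_deviation[OF N D'(1) diam' x0 M iid n S \<alpha> dim] by blast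
  have \<kappa>_ge: "(19 * sqrt (real d + 2) + sqrt (2 * ln (1 / \<alpha>))) / sqrt n \<le> \<kappa>"
    unfolding \<kappa>_def by (intro divide_right_mono add_right_mono mult_right_mono) auto
  let ?E = "{\<omega> \<in> space M. epowr (max_sliced_wasserstein r N (empirical_measure n (\<lambda>i. X i \<omega>)) P) r
             \<le> ennreal (C / sqrt (real n))}"
  have "A \<subseteq> ?E"
  proof
    fix \<omega> assume \<omega>: "\<omega> \<in> A"
    have "epowr (wasserstein r (sliced \<gamma> (empirical_measure n (\<lambda>i. X i \<omega>))) (sliced \<gamma> P)) r \<le> ennreal (C / sqrt n)"
      if \<gamma>: "N \<gamma> = 1" for \<gamma>
    proof -
      obtain f where f: "\<And>s t. \<bar>f s - f t\<bar> \<le> \<bar>s - t :: real\<bar>"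
        and le: "epowr (wasserstein r (sliced \<gamma> (empirical_measure n (\<lambda>i. X i \<omega>))) (sliced \<gamma> P)) r
          \<le> ennreal (D powr (r - 1) * ((\<Sum>i<n. f (X i \<omega> \<bullet> \<gamma>)) / n - (\<integral>z. f (z \<bullet> \<gamma>) \<partial>P)))"
        by (rule sliced_wasserstein_le_lipschitz_dual[OF P.prob_space_axioms assms(7) S, of n "\<lambda>i. X i \<omega>" r \<gamma> D])
           (use AX[OF \<omega>] n r diam[of _ _ \<gamma>] \<gamma> in auto)
      have "D powr (r - 1) * ((\<Sum>i<n. f (X i \<omega> \<bullet> \<gamma>)) / n - (\<integral>z. f (z \<bullet> \<gamma>) \<partial>P)) \<le> C / sqrt n"
      proof (cases "D = 0")
        case True
        \<comment> \<open>Both sides are \<open>0\<close>, since \<open>0 powr s = 0\<close> for every exponent \<open>s\<close>, also for \<open>s = r - 1 = 0\<close>.\<close>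
        then show ?thesis unfolding C by simp
      next
        case False
        then have DD: "D' = D" "D > 0" using D0 by (auto simp: D'_def)
        obtain \<phi> b where \<phi>: "\<phi> \<in> lipschitz_ridge N x0 D" "\<And>z. f (z \<bullet> \<gamma>) = D * \<phi> z + b"
          by (rule lipschitz_slice_as_ridge[where f = f and N = N and g = \<gamma> and ?x0.0 = x0, OF f \<gamma> DD(2)]) (rule that)
        have int: "integrable P \<phi>"
        proof (rule P.integrable_const_bound)
          show "AE x in P. norm (\<phi> x) \<le> \<bar>\<phi> x0\<bar> + 1"
            using S(2) by eventually_elim
              (use lipschitz_ridge_range[OF DD(2) diam'[unfolded DD(1)] \<phi>(1) _ x0] in \<open>smt (verit) real_norm_def\<close>)
        qed (use lipschitz_ridge_measurable[OF DD(2) \<phi>(1)] measurable_cong_sets[OF assms(7) refl] in blast)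
        have "(\<Sum>i<n. f (X i \<omega> \<bullet> \<gamma>)) / n - (\<integral>z. f (z \<bullet> \<gamma>) \<partial>P)
          = D * ((\<Sum>i<n. \<phi> (X i \<omega>)) / n - (\<integral>x. \<phi> x \<partial>P))"
          using int n by (simp add: \<phi>(2) sum.distrib sum_distrib_left[symmetric] P.prob_space add_divide_distrib algebra_simps)
        also have "\<dots> \<le> D * \<kappa>"
          using Adev[OF \<omega>, of \<phi>] \<kappa>_ge \<phi>(1) DD by (intro mult_left_mono) auto
        finally have "D powr (r - 1) * ((\<Sum>i<n. f (X i \<omega> \<bullet> \<gamma>)) / n - (\<integral>z. f (z \<bullet> \<gamma>) \<partial>P))
            \<le> D powr (r - 1) * (D * \<kappa>)"
          by (rule mult_left_mono) simp
        also have "\<dots> = \<kappa> * D powr r" using DD by (simp add: powr_diff)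
        finally show ?thesis unfolding C .
      qed
      then show ?thesis using le by (meson ennreal_leI order_trans)
    qed
    moreover have "\<omega> \<in> space M" using \<omega> A(1) sets.sets_into_space by blast
    moreover have "C / sqrt n \<ge> 0" unfolding C using \<kappa>0 by simp
    ultimately show "\<omega> \<in> ?E" using r by (simp add: max_sliced_wasserstein_le_iff)
  qed
  moreover have "?E \<in> sets M"
  proof (rule max_sliced_wasserstein_event_measurable[OF r])
    show "C / sqrt n \<ge> 0" unfolding C using \<kappa>0 by simp
    show "X i \<in> M \<rightarrow>\<^sub>M borel" if "i < n" for i
      using iid(1) that by (auto simp: M.indep_vars_def)
  qed (use n in simp)
  ultimately have "measure M A \<le> measure M ?E"
    by (intro M.finite_measure_mono)
  then show ?thesis using A(2) by linarith
qed

end
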